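(* Let $\theta,\sigma$ be actions of an inverse semigroup $S$ on locally compact Hausdorff spaces $X,Y$, respectively, and let $f\colon Y\to X$ be an $S$-equivariant map (not assumed continuous). Let $\rho=f^{\mathrm{KS}}\circ\iota_Y\colon Y\to X^{\mathrm{KS}}$, which is an $S$-equivariant map given by $\rho(y)(e)=f(y)$ if $y\in Y_e$ and $\rho(y)(e)=\infty_e$ otherwise ($y\in Y$, $e\in E(S)$). Then the groupoid homomorphism $$\widetilde\rho\colon S\ltimes Y\to S\ltimes X^{\mathrm{KS}},\qquad \widetilde\rho([s,y])=[s,\rho(y)],$$ is $\mathbf d$-bijective. Moreover, the following hold. (i) $\widetilde\rho$ is Borel if $S^X=\{s\in S\mid X_{s^*s}\neq\emptyset\}$ is countable and $f$ is Borel. (ii) $\widetilde\rho$ is continuous if $f$ is continuous and $Y_e$ is closed (in $Y$) for each $e\in E(S)$.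
   Context: An inverse semigroup is a semigroup $S$ in which every $s$ has a unique $s^*$ with $ss^*s=s$, $s^*ss^*=s^*$; $E(S)$ is its commutative subsemigroup of idempotents; $s\le t$ means $ts^*s=s$. An action $\theta$ of $S$ on a topological space $X$ is a semigroup homomorphism $s\mapsto\theta_s$ from $S$ to the inverse semigroup of partial bijections of $X$ (bijections between subsets, composed on the largest possible domain) such that, writing $X_e$ for the subset on which $\theta_e$ ($e\in E(S)$) is the identity (so $\theta_s$ is a bijection $X_{s^*s}\to X_{ss^*}$): each $X_e$ is open, each $\theta_s\colon X_{s^*s}\to X_{ss^*}$ is continuous, and $\bigcup_{e\in E(S)}X_e=X$. A map $f\colon Y\to X$ between spaces with $S$-actions $\sigma,\theta$ is $S$-equivariant if $f(Y_e)\subset X_e$ for all $e\in E(S)$ and $f(\sigma_s(y))=\theta_s(f(y))$ for all $s\in S$, $y\in Y_{s^*s}$. The space $X^{\mathrm{KS}}$: let $\widetilde{X_e}=X_e\sqcup\{\infty_e\}$ be the one-point compactification of $X_e$ (a point $\infty_e$ is added even when $X_e$ is compact). Let $\widetilde{X^{\mathrm{KS}}}$ be the set of $\tau\in\prod_{e\in E(S)}\widetilde{X_e}$ such that (1) if $e_1\le e_2$ and $\tau(e_1)\ne\infty_{e_1}$, then $\tau(e_2)=\tau(e_1)$; (2) if $\tau(e_1)\neq\infty_{e_1}$ and $\tau(e_2)\neq\infty_{e_2}$, then $\tau(e_1e_2)\neq\infty_{e_1e_2}$; with the topology induced from the product topology. Set $X^{\mathrm{KS}}=\widetilde{X^{\mathrm{KS}}}\setminus\{\infty\}$,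 $\infty=(\infty_e)_e$; it is locally compact Hausdorff. $S$ acts on $X^{\mathrm{KS}}$ by $X^{\mathrm{KS}}_e=\{\tau\in X^{\mathrm{KS}}\mid\tau(e)\ne\infty_e\}$ and $\theta^{\mathrm{KS}}_s\colon X^{\mathrm{KS}}_{s^*s}\to X^{\mathrm{KS}}_{ss^*}$, $\theta^{\mathrm{KS}}_s(\tau)(e)=\theta_{es}(\tau(s^*es))$ if $\tau(s^*es)\neq\infty_{s^*es}$ and $\infty_e$ otherwise. $Y^{\mathrm{KS}}$ is defined in the same way. The map $\iota_Y\colon Y\to Y^{\mathrm{KS}}$ sends $y$ to the element with value $y$ at $e$ if $y\in Y_e$ and $\infty_e$ otherwise. For an $S$-equivariant $f\colon Y\to X$, $f^{\mathrm{KS}}\colon Y^{\mathrm{KS}}\to X^{\mathrm{KS}}$ is $f^{\mathrm{KS}}(\tau)(e)=f(\tau(e))$ if $\tau(e)\neq\infty_e$ and $\infty_e$ otherwise. Transformation groupoid: for an action $\theta$ of $S$ on a locally compact Hausdorff space $Z$, $S\ltimes Z$ is the set of classes $[s,z]$ of pairs $(s,z)$, $z\in Z_{s^*s}$, under $(s,z)\sim(t,w)$ iff $z=w$ and $se=te$, $z\in Z_e$ for some $e\in E(S)$; unit space $\{[e,z]\}\cong Z$, $d([s,z])=z$, $r([s,z])=\theta_s(z)$, $[t,\theta_s(z)][s,z]=[ts,z]$, $[s,z]^{-1}=[s^*,\theta_s(z)]$; basis of open sets $[s,U]=\{[s,z]\mid z\in U\}$, $U\subset Z_{s^*s}$ open.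 A groupoid homomorphism $g\colon G\to H$ is $\mathbf d$-bijective if for every unit $x\in G^{(0)}$ the restriction $g|_{G_x}\colon G_x\to H_{g(x)}$ is bijective, where $G_x=\{\gamma\in G\mid d(\gamma)=x\}$. Borel means measurable with respect to the $\sigma$-algebras generated by the open sets. *)

theory Defs
  imports "HOL-Analysis.Analysis"
begin

section \<open>Inverse semigroups\<close>

class inverse_semigroup = semigroup_mult +
  assumes ex1_star: "\<exists>!t. s * t * s = s \<and> t * s * t = t"

definition star :: "'s::inverse_semigroup \<Rightarrow> 's" where
  "star s = (THE t. s * t * s = s \<and> t * s * t = t)"

definition idempotents :: "'s::inverse_semigroup set" where
  "idempotents = {e. e * e = e}"

definition isg_le :: "'s::inverse_semigroup \<Rightarrow> 's \<Rightarrow> bool" where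
  "isg_le s t \<longleftrightarrow> t * star s * s = s"


section \<open>Actions on topological spaces\<close>

text \<open>Partial maps of a space are rendered as functions of type \<^typ>\<open>'x \<Rightarrow> 'x option\<close>;
  the map composition \<^term>\<open>g \<circ>\<^sub>m h\<close> is composition on the largest possible domain, and the
  value of the partial map \<^term>\<open>h\<close> at a point \<^term>\<open>x\<close> of its domain is \<^term>\<open>the (h x)\<close>.\<close>

definition partial_bijection :: "'x set \<Rightarrow> ('x \<rightharpoonup> 'x) \<Rightarrow> bool" where
  "partial_bijection A h \<longleftrightarrow> dom h \<subseteq> A \<and> ran h \<subseteq> A \<and> inj_on h (dom h)"

text \<open>For idempotent \<^term>\<open>e\<close> this is the set $X_e$.\<close>

definition act_set :: "('s::inverse_semigroup \<Rightarrow> 'x \<rightharpoonup> 'x) \<Rightarrow> 's \<Rightarrow> 'x set" where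
  "act_set \<theta> e = {x. \<theta> e x = Some x}"

definition isg_action :: "'x topology \<Rightarrow> ('s::inverse_semigroup \<Rightarrow> 'x \<rightharpoonup> 'x) \<Rightarrow> bool" where
  "isg_action X \<theta> \<longleftrightarrow>
     (\<forall>s. partial_bijection (topspace X) (\<theta> s)) \<and>
     (\<forall>s t. \<theta> (s * t) = \<theta> s \<circ>\<^sub>m \<theta> t) \<and>
     (\<forall>e\<in>idempotents. openin X (act_set \<theta> e)) \<and>
     (\<forall>s. continuous_map (subtopology X (act_set \<theta> (star s * s)))
                          (subtopology X (act_set \<theta> (s * star s))) (\<lambda>x. the (\<theta> s x))) \<and>
     (\<Union>e\<in>idempotents. act_set \<theta> e) = topspace X"

definition equivariant_map ::
  "'y topology \<Rightarrow> ('s::inverse_semigroup \<Rightarrow> 'y \<rightharpoonup> 'y) \<Rightarrow>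
   'x topology \<Rightarrow> ('s \<Rightarrow> 'x \<rightharpoonup> 'x) \<Rightarrow> ('y \<Rightarrow> 'x) \<Rightarrow> bool" where
  "equivariant_map Y \<sigma> X \<theta> f \<longleftrightarrow>
     f \<in> topspace Y \<rightarrow> topspace X \<and>
     (\<forall>e\<in>idempotents. f ` act_set \<sigma> e \<subseteq> act_set \<theta> e) \<and>
     (\<forall>s. \<forall>y\<in>act_set \<sigma> (star s * s). f (the (\<sigma> s y)) = the (\<theta> s (f y)))"


section \<open>The space $X^{\mathrm{KS}}$ and its action\<close>

text \<open>The point at infinity of each one-point compactification is \<^term>\<open>None\<close>. Elements of the
  product over the idempotents are functions on the whole semigroup that take the value
  \<^term>\<open>undefined\<close> off the idempotents.\<close>

definition KS_product ::
  "'x topology \<Rightarrow> ('s::inverse_semigroup \<Rightarrow> 'x \<rightharpoonup> 'x) \<Rightarrow> ('s \<Rightarrow> 'x option) topology" where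
  "KS_product X \<theta> =
     product_topology (\<lambda>e. Alexandroff_compactification (subtopology X (act_set \<theta> e))) idempotents"

definition KS_tilde ::
  "'x topology \<Rightarrow> ('s::inverse_semigroup \<Rightarrow> 'x \<rightharpoonup> 'x) \<Rightarrow> ('s \<Rightarrow> 'x option) set" where
  "KS_tilde X \<theta> = {\<tau> \<in> topspace (KS_product X \<theta>).
     (\<forall>e1\<in>idempotents. \<forall>e2\<in>idempotents. isg_le e1 e2 \<and> \<tau> e1 \<noteq> None \<longrightarrow> \<tau> e2 = \<tau> e1) \<and>
     (\<forall>e1\<in>idempotents. \<forall>e2\<in>idempotents. \<tau> e1 \<noteq> None \<and> \<tau> e2 \<noteq> None \<longrightarrow> \<tau> (e1 * e2) \<noteq> None)}"

definition KS_infinity :: "'s::inverse_semigroup \<Rightarrow> 'x option" where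
  "KS_infinity = (\<lambda>e\<in>idempotents. None)"

definition KS_space ::
  "'x topology \<Rightarrow> ('s::inverse_semigroup \<Rightarrow> 'x \<rightharpoonup> 'x) \<Rightarrow> ('s \<Rightarrow> 'x option) topology" where
  "KS_space X \<theta> = subtopology (KS_product X \<theta>) (KS_tilde X \<theta> - {KS_infinity})"

definition KS_action ::
  "'x topology \<Rightarrow> ('s::inverse_semigroup \<Rightarrow> 'x \<rightharpoonup> 'x) \<Rightarrow>
   's \<Rightarrow> ('s \<Rightarrow> 'x option) \<rightharpoonup> ('s \<Rightarrow> 'x option)" where
  "KS_action X \<theta> s \<tau> =
     (if \<tau> \<in> topspace (KS_space X \<theta>) \<and> \<tau> (star s * s) \<noteq> None
      then Some (\<lambda>e\<in>idempotents.
             case \<tau> (star s * e * s) of None \<Rightarrow> None | Some x \<Rightarrow> Some (the (\<theta> (e * s) x)))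
      else None)"

definition KS_iota :: "('s::inverse_semigroup \<Rightarrow> 'y \<rightharpoonup> 'y) \<Rightarrow> 'y \<Rightarrow> 's \<Rightarrow> 'y option" where
  "KS_iota \<sigma> y = (\<lambda>e\<in>idempotents. if y \<in> act_set \<sigma> e then Some y else None)"

definition KS_map ::
  "('y \<Rightarrow> 'x) \<Rightarrow> ('s::inverse_semigroup \<Rightarrow> 'y option) \<Rightarrow> 's \<Rightarrow> 'x option" where
  "KS_map f \<tau> = (\<lambda>e\<in>idempotents. case \<tau> e of None \<Rightarrow> None | Some y \<Rightarrow> Some (f y))"


section \<open>Groupoids\<close>

text \<open>The unit space is a subset of the set of arrows.\<close>

record 'g groupoid_data =
  arrows :: "'g set"
  units :: "'g set"
  source :: "'g \<Rightarrow> 'g"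
  target :: "'g \<Rightarrow> 'g"
  compose_arrows :: "'g \<Rightarrow> 'g \<Rightarrow> 'g"
  inverse_arrow :: "'g \<Rightarrow> 'g"

definition groupoid :: "'g groupoid_data \<Rightarrow> bool" where
  "groupoid G \<longleftrightarrow>
     units G \<subseteq> arrows G \<and>
     (\<forall>a\<in>arrows G. source G a \<in> units G \<and> target G a \<in> units G) \<and>
     (\<forall>x\<in>units G. source G x = x \<and> target G x = x) \<and>
     (\<forall>a\<in>arrows G. \<forall>b\<in>arrows G. source G a = target G b \<longrightarrow>
        compose_arrows G a b \<in> arrows G \<and> source G (compose_arrows G a b) = source G b \<and>
        target G (compose_arrows G a b) = target G a) \<and>
     (\<forall>a\<in>arrows G. \<forall>b\<in>arrows G. \<forall>c\<in>arrows G.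
        source G a = target G b \<and> source G b = target G c \<longrightarrow>
        compose_arrows G (compose_arrows G a b) c = compose_arrows G a (compose_arrows G b c)) \<and>
     (\<forall>a\<in>arrows G. compose_arrows G a (source G a) = a \<and> compose_arrows G (target G a) a = a) \<and>
     (\<forall>a\<in>arrows G. inverse_arrow G a \<in> arrows G \<and>
        source G (inverse_arrow G a) = target G a \<and> target G (inverse_arrow G a) = source G a \<and>
        compose_arrows G (inverse_arrow G a) a = source G a \<and> compose_arrows G a (inverse_arrow G a) = target G a)"

definition groupoid_hom :: "'g groupoid_data \<Rightarrow> 'h groupoid_data \<Rightarrow> ('g \<Rightarrow> 'h) \<Rightarrow> bool" where
  "groupoid_hom G H g \<longleftrightarrow>
     groupoid G \<and> groupoid H \<and> g \<in> arrows G \<rightarrow> arrows H \<and>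
     (\<forall>a\<in>arrows G. \<forall>b\<in>arrows G. source G a = target G b \<longrightarrow>
        source H (g a) = target H (g b) \<and> g (compose_arrows G a b) = compose_arrows H (g a) (g b))"

definition source_fibre :: "'g groupoid_data \<Rightarrow> 'g \<Rightarrow> 'g set" where
  "source_fibre G x = {a \<in> arrows G. source G a = x}"

definition d_bijective :: "'g groupoid_data \<Rightarrow> 'h groupoid_data \<Rightarrow> ('g \<Rightarrow> 'h) \<Rightarrow> bool" where
  "d_bijective G H g \<longleftrightarrow>
     (\<forall>x\<in>units G. bij_betw g (source_fibre G x) (source_fibre H (g x)))"


section \<open>Transformation groupoids\<close>

definition germ_pairs :: "('s::inverse_semigroup \<Rightarrow> 'z \<rightharpoonup> 'z) \<Rightarrow> ('s \<times> 'z) set" where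
  "germ_pairs \<theta> = {(s, z). z \<in> act_set \<theta> (star s * s)}"

definition germ_rel ::
  "('s::inverse_semigroup \<Rightarrow> 'z \<rightharpoonup> 'z) \<Rightarrow> (('s \<times> 'z) \<times> ('s \<times> 'z)) set" where
  "germ_rel \<theta> = {((s, z), (t, w)). (s, z) \<in> germ_pairs \<theta> \<and> (t, w) \<in> germ_pairs \<theta> \<and>
     z = w \<and> (\<exists>e\<in>idempotents. s * e = t * e \<and> z \<in> act_set \<theta> e)}"

definition germ :: "('s::inverse_semigroup \<Rightarrow> 'z \<rightharpoonup> 'z) \<Rightarrow> 's \<Rightarrow> 'z \<Rightarrow> ('s \<times> 'z) set" where
  "germ \<theta> s z = germ_rel \<theta> `` {(s, z)}"

text \<open>A point \<^term>\<open>z\<close> of the space is identified with the unit \<^term>\<open>germ \<theta> e z\<close>, where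
  \<^term>\<open>e\<close> is any idempotent with \<^term>\<open>z \<in> act_set \<theta> e\<close>. Hence the source \<^term>\<open>z\<close> of
  \<^term>\<open>germ \<theta> s z\<close> appears as \<^term>\<open>germ \<theta> (star s * s) z\<close>, and similarly for the target.\<close>

definition transformation_groupoid ::
  "('s::inverse_semigroup \<Rightarrow> 'z \<rightharpoonup> 'z) \<Rightarrow> ('s \<times> 'z) set groupoid_data" where
  "transformation_groupoid \<theta> = \<lparr>
     arrows = germ_pairs \<theta> // germ_rel \<theta>,
     units = {germ \<theta> e z | e z. e \<in> idempotents \<and> z \<in> act_set \<theta> e},
     source = (\<lambda>a. THE u. \<exists>s z. (s, z) \<in> germ_pairs \<theta> \<and> a = germ \<theta> s z \<and>
                 u = germ \<theta> (star s * s) z),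
     target = (\<lambda>a. THE u. \<exists>s z. (s, z) \<in> germ_pairs \<theta> \<and> a = germ \<theta> s z \<and>
                 u = germ \<theta> (s * star s) (the (\<theta> s z))),
     compose_arrows = (\<lambda>a b. THE c. \<exists>t s z. (s, z) \<in> germ_pairs \<theta> \<and> (t, the (\<theta> s z)) \<in> germ_pairs \<theta> \<and>
                 a = germ \<theta> t (the (\<theta> s z)) \<and> b = germ \<theta> s z \<and> c = germ \<theta> (t * s) z),
     inverse_arrow = (\<lambda>a. THE b. \<exists>s z. (s, z) \<in> germ_pairs \<theta> \<and> a = germ \<theta> s z \<and>
                 b = germ \<theta> (star s) (the (\<theta> s z)))\<rparr>"

text \<open>For an action on a space \<^term>\<open>Z\<close> the sets below are closed under finite intersections up
  to unions, so they are a base of the topology they generate.\<close>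

definition transformation_topology ::
  "'z topology \<Rightarrow> ('s::inverse_semigroup \<Rightarrow> 'z \<rightharpoonup> 'z) \<Rightarrow> ('s \<times> 'z) set topology" where
  "transformation_topology Z \<theta> = topology_generated_by
     {germ \<theta> s ` U | s U. openin Z U \<and> U \<subseteq> act_set \<theta> (star s * s)}"

text \<open>The map $[s,y] \mapsto [s,\rho(y)]$.\<close>

definition transformation_map ::
  "('s::inverse_semigroup \<Rightarrow> 'y \<rightharpoonup> 'y) \<Rightarrow> ('s \<Rightarrow> 'z \<rightharpoonup> 'z) \<Rightarrow> ('y \<Rightarrow> 'z) \<Rightarrow>
   ('s \<times> 'y) set \<Rightarrow> ('s \<times> 'z) set" where
  "transformation_map \<sigma> \<theta> \<rho> a =
     (THE b. \<exists>s y. (s, y) \<in> germ_pairs \<sigma> \<and> a = germ \<sigma> s y \<and> b = germ \<theta> s (\<rho> y))"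


section \<open>Borel maps\<close>

definition borel_algebra :: "'a topology \<Rightarrow> 'a measure" where
  "borel_algebra T = sigma (topspace T) {U. openin T U}"

definition borel_map :: "'a topology \<Rightarrow> 'b topology \<Rightarrow> ('a \<Rightarrow> 'b) \<Rightarrow> bool" where
  "borel_map S T f \<longleftrightarrow> f \<in> borel_algebra S \<rightarrow>\<^sub>M borel_algebra T"

end

theory Submission
  imports Defs
begin

text \<open>Write \<open>Y\<^sub>e\<close> for the domain of the idempotent \<open>e\<close> acting on \<open>Y\<close>, and \<open>[s, y]\<close> for the germ of
  \<open>s\<close> at \<open>y\<close>. The map \<open>f\<close> sends \<open>Y\<^sub>e\<close> into \<open>X\<^sub>e\<close>, but points outside \<open>Y\<^sub>e\<close> may land in \<open>X\<^sub>e\<close> as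
  well, so germs at \<open>f y\<close> need not come from germs at \<open>y\<close>. The element \<open>\<rho> y\<close> of $X^{\mathrm{KS}}$
  remembers, besides the point \<open>f y\<close>, exactly which idempotents are defined at \<open>y\<close>. Therefore
  \<open>\<rho> y\<close> lies in the domain of \<open>e\<close> if and only if \<open>y\<close> does. Any equivariant map with this property
  induces a \<open>d\<close>-bijective homomorphism of germ groupoids (locale \<open>germ_map\<close>): a germ of \<open>s\<close> at
  \<open>\<rho> y\<close> lifts to the germ of \<open>s\<close> at \<open>y\<close>, and an idempotent witnessing an equality of germs at
  \<open>\<rho> y\<close> is also defined at \<open>y\<close>.

  To compute with the action on $X^{\mathrm{KS}}$, an element is described by a point \<open>x\<close> and a filter
  of idempotents whose domains contain \<open>x\<close> (\<open>KS_space_cases\<close>). The action then moves the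
  point and conjugates the filter (\<open>KS_action_point\<close>), from which the laws of an action follow.

  For the topological claims, \<open>d\<close>-bijectivity shows that the preimage of the set \<open>[s, U]\<close> of germs
  is \<open>[s, \<rho> -` U]\<close> (\<open>transformation_map_vimage_germ\<close>), so everything reduces to \<open>\<rho>\<close>. If \<open>f\<close> is continuous
  and each \<open>Y\<^sub>e\<close> is clopen, then each coordinate of \<open>\<rho>\<close> is continuous, being \<open>f\<close> on \<open>Y\<^sub>e\<close> and
  constant off it. If \<open>f\<close> is Borel and countably many elements have nonempty domain in \<open>X\<close>, then
  an open set of germs is a countable union of sets \<open>[s, U]\<close>. The remaining point is that preimages under
  \<open>\<rho>\<close> of arbitrary open sets are Borel (\<open>borel_map_\<rho>\<close>): the finite coordinates of \<open>\<rho> y\<close> are all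
  equal to \<open>f y\<close>, so such a preimage is a countable union of pieces, each cut out by finitely
  many of the sets \<open>Y\<^sub>e\<close> and by the preimage under \<open>f\<close> of one open subset of \<open>X\<close>.\<close>


section \<open>Inverse semigroups\<close>

lemma star_inverse: "s * star s * s = s" "star s * s * star s = star s"
  using theI'[OF ex1_star[of s]] unfolding star_def by blast+

lemma star_unique: "s * t * s = s \<Longrightarrow> t * s * t = t \<Longrightarrow> star s = t"
  using ex1_star[of s] star_inverse[of s] by blast

lemma star_star [simp]: "star (star s) = s"
  by (rule star_unique) (simp_all add: star_inverse)

lemma idempotent_square: "e \<in> idempotents \<Longrightarrow> e * e = e" "e \<in> idempotents \<Longrightarrow> e * (e * s) = e * s"
  by (simp_all add: idempotents_def flip: mult.assoc)

lemma star_idempotent: "e \<in> idempotents \<Longrightarrow> star e = e"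
  by (rule star_unique) (simp_all add: idempotents_def)

lemma star_cancel: "s * (star s * s) = s" "s * (star s * (s * t)) = s * t"
  "star s * (s * star s) = star s" "star s * (s * (star s * t)) = star s * t"
  using star_inverse[of s] by (metis mult.assoc)+

lemma star_mult_idempotent [intro, simp]:
  "star s * s \<in> idempotents" "s * star s \<in> idempotents"
  by (simp_all add: idempotents_def mult.assoc star_cancel)

text \<open>With \<open>x\<close> the inverse of \<open>e * f\<close>, the element \<open>f * x * e\<close> is also an inverse of \<open>e * f\<close>,
  and it is idempotent. By uniqueness \<open>x\<close> is idempotent, hence equal to its own inverse
  \<open>e * f\<close>.\<close>

lemma idempotents_mult:
  assumes "e \<in> idempotents" "f \<in> idempotents"
  shows "e * f \<in> idempotents"
proof -
  define x where "x = star (e * f)"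
  note ee = idempotent_square[OF assms(1)] idempotent_square[OF assms(2)]
  have x: "e * (f * (x * (e * f))) = e * f" "x * (e * (f * x)) = x"
    using star_inverse[of "e * f"] by (simp_all add: x_def mult.assoc)
  have x': "x * (e * (f * (x * t))) = x * t" for t
    using x(2) by (metis mult.assoc)
  have fxe: "f * x * e = x"
    unfolding x_def
    by (rule star_unique[symmetric])
      (simp_all add: mult.assoc ee x x' flip: x_def)
  have "f * x * e * (f * x * e) = f * x * e"
    by (simp add: mult.assoc ee x')
  then have "x \<in> idempotents"
    unfolding fxe by (simp add: idempotents_def)
  then have "x = e * f"
    using star_idempotent[of x] unfolding x_def by simp
  with \<open>x \<in> idempotents\<close> show ?thesis by simp
qed

lemma idempotents_commute:
  assumes "e \<in> idempotents" "f \<in> idempotents"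
  shows "e * f = f * e"
proof -
  have ef: "e * f * (e * f) = e * f" "f * e * (f * e) = f * e"
    using idempotents_mult[of e f] idempotents_mult[of f e] assms by (auto simp: idempotents_def)
  note ee = idempotent_square[OF assms(1)] idempotent_square[OF assms(2)]
  have "star (e * f) = f * e"
    using ef by (intro star_unique) (simp_all add: mult.assoc ee)
  then show ?thesis
    using star_idempotent[OF idempotents_mult[OF assms]] by simp
qed

lemma star_mult: "star (s * t) = star t * star s"
proof (rule star_unique)
  have c: "t * star t * (star s * s) = star s * s * (t * star t)"
    by (rule idempotents_commute) auto
  show "s * t * (star t * star s) * (s * t) = s * t"
  proof -
    have "s * t * (star t * star s) * (s * t) = s * (t * star t * (star s * s)) * t"
      by (simp add: mult.assoc)
    also have "\<dots> = s * t"
      unfolding c by (simp add: mult.assoc star_cancel)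
    finally show ?thesis .
  qed
  show "star t * star s * (s * t) * (star t * star s) = star t * star s"
  proof -
    have "star t * star s * (s * t) * (star t * star s)
        = star t * (star s * s * (t * star t)) * star s"
      by (simp add: mult.assoc)
    also have "\<dots> = star t * star s"
      unfolding c[symmetric] by (simp add: mult.assoc star_cancel)
    finally show ?thesis .
  qed
qed

lemma idempotent_conjugate:
  assumes "e \<in> idempotents"
  shows "s * star s * e * s = e * s" and "star s * e * s \<in> idempotents"
proof -
  have "s * star s * e = e * (s * star s)"
    by (rule idempotents_commute) (use assms in auto)
  then show 1: "s * star s * e * s = e * s"
    by (simp add: mult.assoc star_cancel)
  have "star s * e * s * (star s * e * s) = star s * e * (s * star s * e * s)"
    by (simp add: mult.assoc)
  also have "\<dots> = star s * (e * e) * s"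
    unfolding 1 by (simp add: mult.assoc)
  finally show "star s * e * s \<in> idempotents"
    using assms by (simp add: idempotents_def)
qed

lemma idempotents_le_iff:
  "e \<in> idempotents \<Longrightarrow> isg_le e f \<longleftrightarrow> f * e = e"
  by (simp add: isg_le_def star_idempotent mult.assoc) (simp add: idempotents_def)


section \<open>Actions by partial injections\<close>

text \<open>Germs are formed both for the given actions and for the action on $X^{\mathrm{KS}}$. Their
  algebra rests on a homomorphism into partial injections alone. In what follows a point in the domain of \<open>\<theta> s\<close> is most often given by an equation
  \<open>\<theta> s z = Some w\<close>, which names its image as well.\<close>

locale partial_action =
  fixes \<theta> :: "'s::inverse_semigroup \<Rightarrow> 'z \<rightharpoonup> 'z"
  assumes inj: "inj_on (\<theta> s) (dom (\<theta> s))"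
    and mult: "\<theta> (s * t) = \<theta> s \<circ>\<^sub>m \<theta> t"
begin

lemma mult_Some: "\<theta> t z = Some w \<Longrightarrow> \<theta> (s * t) z = \<theta> s w"
  by (simp add: mult)

lemma mult_None: "\<theta> t z = None \<Longrightarrow> \<theta> (s * t) z = None"
  by (simp add: mult)

lemma idempotent_fixes:
  assumes "e \<in> idempotents" "\<theta> e z = Some w"
  shows "w = z"
proof -
  have "\<theta> e w = Some w"
    using mult_Some[OF assms(2), of e] assms by (simp add: idempotents_def)
  then show ?thesis
    using inj[of e] assms by (auto simp: inj_on_def dom_def)
qed

lemma act_set_iff: "e \<in> idempotents \<Longrightarrow> z \<in> act_set \<theta> e \<longleftrightarrow> \<theta> e z \<noteq> None"
  unfolding act_set_def by (auto dest: idempotent_fixes)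

lemma act_set_star_iff: "z \<in> act_set \<theta> (star s * s) \<longleftrightarrow> (\<exists>w. \<theta> s z = Some w)"
proof
  assume "z \<in> act_set \<theta> (star s * s)"
  then have "\<theta> (star s * s) z \<noteq> None"
    by (simp add: act_set_def)
  then show "\<exists>w. \<theta> s z = Some w"
    using mult_None[of s z "star s"] by (cases "\<theta> s z") auto
next
  assume "\<exists>w. \<theta> s z = Some w"
  then have "\<theta> (star s * s) z \<noteq> None"
    using mult_None[of "star s * s" z s] by (cases "\<theta> (star s * s) z") (auto simp: star_cancel)
  then show "z \<in> act_set \<theta> (star s * s)"
    by (simp add: act_set_iff)
qed

lemma star_Some:
  assumes "\<theta> s z = Some w"
  shows "\<theta> (star s) w = Some z"
proof -
  have "\<theta> (star s * s) z = Some z"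
    using assms act_set_star_iff[of z s] by (simp add: act_set_def)
  then show ?thesis
    using mult_Some[OF assms, of "star s"] by simp
qed

lemma act_set_mult:
  assumes "e \<in> idempotents" "f \<in> idempotents"
  shows "act_set \<theta> (e * f) = act_set \<theta> e \<inter> act_set \<theta> f"
proof (intro set_eqI iffI)
  fix z assume z: "z \<in> act_set \<theta> (e * f)"
  have "z \<in> act_set \<theta> f'" if "z \<in> act_set \<theta> (e' * f')" "f' \<in> idempotents" for e' f'
    using that mult_None[of f' z e'] by (auto simp: act_set_iff[OF that(2)] act_set_def[of _ "e' * f'"])
  from this[of e f] this[of f e] show "z \<in> act_set \<theta> e \<inter> act_set \<theta> f"
    using z assms idempotents_commute[OF assms] by simp
next
  fix z assume "z \<in> act_set \<theta> e \<inter> act_set \<theta> f"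
  then show "z \<in> act_set \<theta> (e * f)"
    by (simp add: act_set_def mult_Some)
qed

lemma mult_act_set: "z \<in> act_set \<theta> e \<Longrightarrow> \<theta> (s * e) z = \<theta> s z"
  by (simp add: act_set_def mult_Some)

lemma act_set_conjugate:
  assumes "e \<in> idempotents" "\<theta> s z = Some w"
  shows "z \<in> act_set \<theta> (star s * e * s) \<longleftrightarrow> w \<in> act_set \<theta> e"
proof
  assume z: "z \<in> act_set \<theta> (star s * e * s)"
  then have "\<theta> (e * s) z \<noteq> None"
    using mult_None[of "e * s" z "star s"] by (auto simp: act_set_def mult.assoc)
  then show "w \<in> act_set \<theta> e"
    using assms by (simp add: act_set_iff mult_Some)
next
  assume "w \<in> act_set \<theta> e"
  then have "\<theta> (e * s) z = Some w"
    using assms by (simp add: act_set_def mult_Some)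
  then show "z \<in> act_set \<theta> (star s * e * s)"
    using mult_Some[of "e * s" z w "star s"] star_Some[OF assms(2)]
    by (simp add: act_set_def mult.assoc)
qed

end

lemma isg_action_partial_action: "isg_action X \<theta> \<Longrightarrow> partial_action \<theta>"
  by (simp add: isg_action_def partial_action_def partial_bijection_def)


section \<open>The groupoid of germs\<close>

context partial_action
begin

lemma germ_pairs_iff: "(s, z) \<in> germ_pairs \<theta> \<longleftrightarrow> (\<exists>w. \<theta> s z = Some w)"
  by (simp add: germ_pairs_def act_set_star_iff)

lemma equiv_germ_rel: "equiv (germ_pairs \<theta>) (germ_rel \<theta>)"
proof (rule equivI)
  show "germ_rel \<theta> \<subseteq> germ_pairs \<theta> \<times> germ_pairs \<theta>"
    by (auto simp: germ_rel_def)
  show "refl_on (germ_pairs \<theta>) (germ_rel \<theta>)"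
  proof (rule refl_onI)
    fix p assume "p \<in> germ_pairs \<theta>"
    then obtain s z where "p = (s, z)" "z \<in> act_set \<theta> (star s * s)"
      by (auto simp: germ_pairs_def)
    then show "(p, p) \<in> germ_rel \<theta>"
      by (auto simp: germ_rel_def germ_pairs_def)
  qed
  show "sym (germ_rel \<theta>)"
    by (rule symI) (auto simp: germ_rel_def, metis)
  show "trans (germ_rel \<theta>)"
  proof (rule transI)
    fix p q r assume "(p, q) \<in> germ_rel \<theta>" "(q, r) \<in> germ_rel \<theta>"
    then obtain s t u z e f where *: "p = (s, z)" "q = (t, z)" "r = (u, z)"
      "(s, z) \<in> germ_pairs \<theta>" "(u, z) \<in> germ_pairs \<theta>"
      "e \<in> idempotents" "f \<in> idempotents" "s * e = t * e" "t * f = u * f"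
      "z \<in> act_set \<theta> e" "z \<in> act_set \<theta> f"
      by (force simp: germ_rel_def)
    have "s * (e * f) = t * (e * f)" "t * (f * e) = u * (f * e)"
      using *(8,9) by (simp_all flip: mult.assoc)
    then have "s * (e * f) = u * (e * f)"
      using idempotents_commute[OF *(6,7)] by simp
    then show "(p, r) \<in> germ_rel \<theta>"
      using * idempotents_mult[of e f] by (auto simp: germ_rel_def act_set_mult)
  qed
qed

lemma germ_eq_iff:
  assumes "\<theta> s z = Some v" "\<theta> t w = Some v'"
  shows "germ \<theta> s z = germ \<theta> t w \<longleftrightarrow>
    z = w \<and> (\<exists>e\<in>idempotents. s * e = t * e \<and> z \<in> act_set \<theta> e)"
proof -
  have "(s, z) \<in> germ_pairs \<theta>" "(t, w) \<in> germ_pairs \<theta>"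
    using assms by (auto simp: germ_pairs_iff)
  then show ?thesis
    unfolding germ_def using eq_equiv_class_iff[OF equiv_germ_rel, of "(s, z)" "(t, w)"]
    by (simp add: germ_rel_def)
qed

lemma germ_eqI:
  assumes "\<theta> s z = Some v" "\<theta> t z = Some v'"
    and "e \<in> idempotents" "s * e = t * e" "z \<in> act_set \<theta> e"
  shows "germ \<theta> s z = germ \<theta> t z"
  using assms germ_eq_iff by blast

lemma germ_eqD:
  assumes "germ \<theta> s z = germ \<theta> t w" "\<theta> s z = Some v" "\<theta> t w = Some v'"
  obtains e where "z = w" "v = v'" "e \<in> idempotents" "s * e = t * e" "z \<in> act_set \<theta> e"
proof -
  obtain e where e: "z = w" "e \<in> idempotents" "s * e = t * e" "z \<in> act_set \<theta> e"
    using assms germ_eq_iff by blast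
  then have "v = v'"
    using assms mult_act_set[of z e s] mult_act_set[of z e t] by simp
  with e that show thesis by blast
qed

lemma germ_eq_endpoints:
  assumes "germ \<theta> s z = germ \<theta> t w" "\<theta> s z = Some v" "\<theta> t w = Some v'"
  shows "z = w" "v = v'"
  by (rule germ_eqD[OF assms]; assumption)+

text \<open>Any two idempotents defined at \<open>z\<close> have the same germ there, which is why \<open>z\<close> can be
  identified with a unit.\<close>

lemma germ_idempotent_eq:
  assumes "e \<in> idempotents" "f \<in> idempotents" "z \<in> act_set \<theta> e" "z \<in> act_set \<theta> f"
  shows "germ \<theta> e z = germ \<theta> f z"
proof (rule germ_eqI)
  show "\<theta> e z = Some z" "\<theta> f z = Some z"
    using assms by (auto simp: act_set_def)
  show "e * f \<in> idempotents" "z \<in> act_set \<theta> (e * f)"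
    using assms by (simp_all add: idempotents_mult act_set_mult)
  show "e * (e * f) = f * (e * f)"
  proof -
    have "e * (e * f) = e * f" "f * (f * e) = f * e"
      using assms by (simp_all add: idempotent_square)
    then show ?thesis
      using idempotents_commute[OF assms(1,2)] by simp
  qed
qed

lemma germ_idempotent_eqD:
  assumes "germ \<theta> e z = germ \<theta> f w" "z \<in> act_set \<theta> e" "w \<in> act_set \<theta> f"
  shows "z = w"
  using germ_eq_endpoints(1)[OF assms(1)] assms(2,3) by (auto simp: act_set_def)

abbreviation G where "G \<equiv> transformation_groupoid \<theta>"

lemma arrows_iff: "a \<in> arrows G \<longleftrightarrow> (\<exists>s z w. \<theta> s z = Some w \<and> a = germ \<theta> s z)"
  unfolding transformation_groupoid_def quotient_def germ_def using germ_pairs_iff by force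

lemma units_iff: "u \<in> units G \<longleftrightarrow> (\<exists>e z. e \<in> idempotents \<and> z \<in> act_set \<theta> e \<and> u = germ \<theta> e z)"
  by (auto simp: transformation_groupoid_def)

lemma act_set_source: "\<theta> s z = Some w \<Longrightarrow> z \<in> act_set \<theta> (star s * s)"
  by (simp add: act_set_star_iff)

lemma act_set_target: "\<theta> s z = Some w \<Longrightarrow> w \<in> act_set \<theta> (s * star s)"
  using act_set_source[OF star_Some] by simp

lemma source_germ:
  assumes "\<theta> s z = Some w"
  shows "source G (germ \<theta> s z) = germ \<theta> (star s * s) z"
proof -
  have *: "germ \<theta> (star t * t) z' = germ \<theta> (star s * s) z"
    if pair: "(t, z') \<in> germ_pairs \<theta>" and eq: "germ \<theta> s z = germ \<theta> t z'" for t z'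
  proof -
    obtain v where t: "\<theta> t z' = Some v"
      using pair by (auto simp: germ_pairs_iff)
    then have "z = z'"
      using germ_eq_endpoints[OF eq assms t] by simp
    then show ?thesis
      using act_set_source[OF t] act_set_source[OF assms] by (simp add: germ_idempotent_eq)
  qed
  show ?thesis
    unfolding transformation_groupoid_def groupoid_data.simps
  proof (rule the_equality)
    show "\<exists>s' z'. (s', z') \<in> germ_pairs \<theta> \<and> germ \<theta> s z = germ \<theta> s' z' \<and>
        germ \<theta> (star s * s) z = germ \<theta> (star s' * s') z'"
      by (rule exI[of _ s], rule exI[of _ z]) (use assms in \<open>simp add: germ_pairs_iff\<close>)
  qed (elim exE conjE, hypsubst, rule *; assumption)
qed

lemma target_germ:
  assumes "\<theta> s z = Some w"
  shows "target G (germ \<theta> s z) = germ \<theta> (s * star s) w"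
proof -
  have *: "germ \<theta> (t * star t) (the (\<theta> t z')) = germ \<theta> (s * star s) w"
    if pair: "(t, z') \<in> germ_pairs \<theta>" and eq: "germ \<theta> s z = germ \<theta> t z'" for t z'
  proof -
    obtain v where t: "\<theta> t z' = Some v"
      using pair by (auto simp: germ_pairs_iff)
    then have "v = w"
      using germ_eq_endpoints[OF eq assms t] by simp
    then show ?thesis
      using act_set_target[OF t] act_set_target[OF assms] t by (simp add: germ_idempotent_eq)
  qed
  show ?thesis
    unfolding transformation_groupoid_def groupoid_data.simps
  proof (rule the_equality)
    show "\<exists>s' z'. (s', z') \<in> germ_pairs \<theta> \<and> germ \<theta> s z = germ \<theta> s' z' \<and>
        germ \<theta> (s * star s) w = germ \<theta> (s' * star s') (the (\<theta> s' z'))"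
      by (rule exI[of _ s], rule exI[of _ z]) (use assms in \<open>simp add: germ_pairs_iff\<close>)
  qed (elim exE conjE, hypsubst, rule *; assumption)
qed

text \<open>If \<open>s * e = s' * e\<close> and \<open>t * f = t' * f\<close> then \<open>t * s\<close> and \<open>t' * s'\<close> agree on
  \<open>e * (star s * f * s)\<close>, since moving \<open>f\<close> past \<open>s\<close> conjugates it.\<close>

lemma germ_mult_cong:
  assumes "\<theta> s z = Some w" "\<theta> t w = Some v" "\<theta> s' z = Some w" "\<theta> t' w = Some v'"
    and "germ \<theta> s z = germ \<theta> s' z" "germ \<theta> t w = germ \<theta> t' w"
  shows "germ \<theta> (t * s) z = germ \<theta> (t' * s') z"
proof -
  obtain e where e: "e \<in> idempotents" "s * e = s' * e" "z \<in> act_set \<theta> e"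
    by (rule germ_eqD[OF assms(5,1,3)])
  obtain f where f: "f \<in> idempotents" "t * f = t' * f" "w \<in> act_set \<theta> f"
    by (rule germ_eqD[OF assms(6,2,4)])
  let ?g = "star s * f * s"
  have g: "?g \<in> idempotents" "s * ?g = f * s"
    using idempotent_conjugate[OF f(1), of s] by (simp_all add: mult.assoc)
  have "t * s * (e * ?g) = t * (s * ?g) * e"
    using idempotents_commute[OF e(1) g(1)] by (simp add: mult.assoc)
  also have "\<dots> = t' * (s * ?g) * e"
    unfolding g(2) by (simp add: f(2) flip: mult.assoc)
  also have "\<dots> = t' * (s * e) * ?g"
    using idempotents_commute[OF e(1) g(1)] by (simp add: mult.assoc)
  finally have "t * s * (e * ?g) = t' * s' * (e * ?g)"
    unfolding e(2) by (simp add: mult.assoc)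
  moreover have "z \<in> act_set \<theta> (e * ?g)"
    using e(1,3) f(3) g(1) act_set_conjugate[OF f(1) assms(1)] by (simp add: act_set_mult)
  moreover have "\<theta> (t * s) z = Some v" "\<theta> (t' * s') z = Some v'"
    using assms by (simp_all add: mult_Some)
  ultimately show ?thesis
    using germ_eqI idempotents_mult[OF e(1) g(1)] by blast
qed

lemma compose_germ:
  assumes "\<theta> s z = Some w" "\<theta> t w = Some v"
  shows "compose_arrows G (germ \<theta> t w) (germ \<theta> s z) = germ \<theta> (t * s) z"
proof -
  have *: "germ \<theta> (t' * s') z' = germ \<theta> (t * s) z"
    if pairs: "(s', z') \<in> germ_pairs \<theta>" "(t', the (\<theta> s' z')) \<in> germ_pairs \<theta>"
      and eq: "germ \<theta> t w = germ \<theta> t' (the (\<theta> s' z'))" "germ \<theta> s z = germ \<theta> s' z'" for s' t' z'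
  proof -
    obtain w' v' where *: "\<theta> s' z' = Some w'" "\<theta> t' w' = Some v'"
      using pairs by (auto simp: germ_pairs_iff)
    then have "z = z'" "w = w'"
      using germ_eq_endpoints[OF eq(2) assms(1) *(1)] by simp_all
    then show ?thesis
      using germ_mult_cong[OF assms, of s' t' v'] eq * by simp
  qed
  show ?thesis
    unfolding transformation_groupoid_def groupoid_data.simps
  proof (rule the_equality)
    show "\<exists>t' s' z'. (s', z') \<in> germ_pairs \<theta> \<and> (t', the (\<theta> s' z')) \<in> germ_pairs \<theta> \<and>
        germ \<theta> t w = germ \<theta> t' (the (\<theta> s' z')) \<and> germ \<theta> s z = germ \<theta> s' z' \<and>
        germ \<theta> (t * s) z = germ \<theta> (t' * s') z'"
      by (rule exI[of _ t], rule exI[of _ s], rule exI[of _ z])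
        (use assms in \<open>simp add: germ_pairs_iff\<close>)
  qed (elim exE conjE, hypsubst, rule *; assumption)
qed

text \<open>Inversion respects germs: if \<open>s * e = t * e\<close> then \<open>star s\<close> and \<open>star t\<close> agree on the
  conjugate \<open>s * e * star s\<close>.\<close>

lemma inverse_germ:
  assumes "\<theta> s z = Some w"
  shows "inverse_arrow G (germ \<theta> s z) = germ \<theta> (star s) w"
proof -
  have *: "germ \<theta> (star t) (the (\<theta> t z')) = germ \<theta> (star s) w"
    if pair: "(t, z') \<in> germ_pairs \<theta>" and eq: "germ \<theta> s z = germ \<theta> t z'" for t z'
  proof -
    obtain w' where t: "\<theta> t z' = Some w'"
      using pair by (auto simp: germ_pairs_iff)
    obtain e where e: "z = z'" "w = w'" "e \<in> idempotents" "s * e = t * e" "z \<in> act_set \<theta> e"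
      by (rule germ_eqD[OF eq assms t])
    let ?g = "s * e * star s"
    have star_g: "star u * (u * e * star u) = e * star u" for u
      using idempotent_conjugate(1)[OF e(3), of "star u"] by (simp add: mult.assoc)
    have "e * star s = e * star t"
      using star_mult[of s e] star_mult[of t e] e by (simp add: star_idempotent)
    then have "t * e * star t = t * (e * star s)"
      by (simp add: mult.assoc)
    also have "\<dots> = ?g"
      by (simp add: e(4) flip: mult.assoc)
    finally have g: "t * e * star t = ?g" .
    have "star s * ?g = star t * ?g"
      using star_g[of s] star_g[of t] \<open>e * star s = e * star t\<close> unfolding g by simp
    moreover have "?g \<in> idempotents"
      using idempotent_conjugate(2)[OF e(3), of "star s"] by simp
    moreover have "w \<in> act_set \<theta> ?g"
      using act_set_conjugate[OF e(3) star_Some[OF assms]] e by simp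
    ultimately show ?thesis
      using germ_eqI[OF _ star_Some[OF assms], of "star t"] star_Some[OF t] e(2) t by simp
  qed
  show ?thesis
    unfolding transformation_groupoid_def groupoid_data.simps
  proof (rule the_equality)
    show "\<exists>s' z'. (s', z') \<in> germ_pairs \<theta> \<and> germ \<theta> s z = germ \<theta> s' z' \<and>
        germ \<theta> (star s) w = germ \<theta> (star s') (the (\<theta> s' z'))"
      by (rule exI[of _ s], rule exI[of _ z]) (use assms in \<open>simp add: germ_pairs_iff\<close>)
  qed (elim exE conjE, hypsubst, rule *; assumption)
qed

lemma source_eq_target_iff:
  assumes "\<theta> s z = Some w" "\<theta> t z' = Some v"
  shows "source G (germ \<theta> t z') = target G (germ \<theta> s z) \<longleftrightarrow> z' = w"
  unfolding source_germ[OF assms(2)] target_germ[OF assms(1)]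
  using assms germ_idempotent_eqD germ_idempotent_eq[of "star t * t" "s * star s"]
    act_set_source act_set_target by (metis star_mult_idempotent)

theorem groupoid_transformation_groupoid: "groupoid G"
  unfolding groupoid_def
proof (intro conjI ballI impI)
  show "units G \<subseteq> arrows G"
    unfolding subset_iff units_iff arrows_iff act_set_def by blast
next
  fix a assume "a \<in> arrows G"
  then obtain s z w where a: "\<theta> s z = Some w" "a = germ \<theta> s z"
    by (auto simp: arrows_iff)
  note a' = source_germ[OF a(1)] target_germ[OF a(1)] inverse_germ[OF a(1)]
  have s: "\<theta> (star s * s) z = Some z" "\<theta> (s * star s) w = Some w"
    using act_set_source[OF a(1)] act_set_target[OF a(1)] by (auto simp: act_set_def)
  note st = star_Some[OF a(1)]
  show "source G a \<in> units G" "target G a \<in> units G"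
    using s unfolding a a' units_iff act_set_def by blast+
  show "compose_arrows G a (source G a) = a" "compose_arrows G (target G a) a = a"
    unfolding a(2) a' using compose_germ[OF s(1) a(1)] compose_germ[OF a(1) s(2)]
    by (simp_all add: star_inverse star_cancel)
  show "inverse_arrow G a \<in> arrows G" "source G (inverse_arrow G a) = target G a"
    "target G (inverse_arrow G a) = source G a"
    unfolding a(2) a' arrows_iff using st source_germ[OF st] target_germ[OF st] by auto
  show "compose_arrows G (inverse_arrow G a) a = source G a"
    "compose_arrows G a (inverse_arrow G a) = target G a"
    unfolding a(2) a' by (simp_all add: compose_germ[OF a(1) st] compose_germ[OF st a(1)])
next
  fix u assume "u \<in> units G"
  then obtain e z where u: "e \<in> idempotents" "\<theta> e z = Some z" "u = germ \<theta> e z"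
    by (auto simp: units_iff act_set_def)
  have "star e * e = e" "e * star e = e"
    using u(1) by (simp_all add: star_idempotent idempotent_square)
  then show "source G u = u" "target G u = u"
    using source_germ[OF u(2)] target_germ[OF u(2)] u by simp_all
next
  fix a b assume "a \<in> arrows G" "b \<in> arrows G" "source G a = target G b"
  then obtain s z w t v where ab: "\<theta> s z = Some w" "b = germ \<theta> s z" "\<theta> t w = Some v" "a = germ \<theta> t w"
    by (auto simp: arrows_iff source_eq_target_iff)
  have ts: "\<theta> (t * s) z = Some v"
    using ab by (simp add: mult_Some)
  show "compose_arrows G a b \<in> arrows G"
    using ts compose_germ[OF ab(1,3)] unfolding ab arrows_iff by blast
  show "source G (compose_arrows G a b) = source G b"
    "target G (compose_arrows G a b) = target G a"
    unfolding ab compose_germ[OF ab(1,3)] source_germ[OF ts] target_germ[OF ts]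
      source_germ[OF ab(1)] target_germ[OF ab(3)]
    by (rule germ_idempotent_eq; use ts ab act_set_source act_set_target in auto)+
next
  fix a b c assume "a \<in> arrows G" "b \<in> arrows G" "c \<in> arrows G"
    "source G a = target G b \<and> source G b = target G c"
  then obtain s z w t v r u where abc: "\<theta> s z = Some w" "c = germ \<theta> s z"
      "\<theta> t w = Some v" "b = germ \<theta> t w" "\<theta> r v = Some u" "a = germ \<theta> r v"
    by (auto simp: arrows_iff source_eq_target_iff)
  have ts: "\<theta> (t * s) z = Some v" and rt: "\<theta> (r * t) w = Some u"
    using abc by (simp_all add: mult_Some)
  show "compose_arrows G (compose_arrows G a b) c = compose_arrows G a (compose_arrows G b c)"
    unfolding abc compose_germ[OF abc(1,3)] compose_germ[OF abc(3,5)]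
      compose_germ[OF ts abc(5)] compose_germ[OF abc(1) rt]
    by (simp add: mult.assoc)
qed

end


lemma (in partial_action) source_fibre_germ:
  assumes "e \<in> idempotents" "z \<in> act_set \<theta> e"
  shows "source_fibre G (germ \<theta> e z) = {germ \<theta> s z | s. \<exists>w. \<theta> s z = Some w}" (is "?L = ?R")
proof (intro equalityI subsetI)
  fix a assume "a \<in> ?L"
  then obtain s z' w where a: "\<theta> s z' = Some w" "a = germ \<theta> s z'" "source G a = germ \<theta> e z"
    unfolding source_fibre_def arrows_iff by blast
  then have "z' = z"
    using germ_idempotent_eqD[OF _ act_set_source[OF a(1)] assms(2)] source_germ[OF a(1)] by simp
  then show "a \<in> ?R"
    using a by blast
next
  fix a assume "a \<in> ?R"
  then obtain s w where a: "\<theta> s z = Some w" "a = germ \<theta> s z"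
    by blast
  have "germ \<theta> (star s * s) z = germ \<theta> e z"
    using assms act_set_source[OF a(1)] by (intro germ_idempotent_eq) auto
  then show "a \<in> ?L"
    using a source_germ[OF a(1)] unfolding source_fibre_def arrows_iff by auto
qed


section \<open>Topology of the germ groupoid\<close>

context partial_action
begin

lemma openin_germ_image:
  "openin Z U \<Longrightarrow> U \<subseteq> act_set \<theta> (star s * s) \<Longrightarrow> openin (transformation_topology Z \<theta>) (germ \<theta> s ` U)"
  unfolding transformation_topology_def by (rule topology_generated_by_Basis) blast

lemma topspace_transformation_topology:
  assumes "\<And>e. e \<in> idempotents \<Longrightarrow> openin Z (act_set \<theta> e)"
  shows "topspace (transformation_topology Z \<theta>) = arrows G"
proof
  show "topspace (transformation_topology Z \<theta>) \<subseteq> arrows G"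
    unfolding transformation_topology_def topology_generated_by_topspace
    by (auto simp: arrows_iff subset_iff act_set_star_iff) blast
  show "arrows G \<subseteq> topspace (transformation_topology Z \<theta>)"
  proof
    fix a assume "a \<in> arrows G"
    then obtain s z w where a: "\<theta> s z = Some w" "a = germ \<theta> s z"
      unfolding arrows_iff by blast
    have "openin (transformation_topology Z \<theta>) (germ \<theta> s ` act_set \<theta> (star s * s))"
      by (rule openin_germ_image) (simp_all add: assms)
    then show "a \<in> topspace (transformation_topology Z \<theta>)"
      using openin_subset act_set_source[OF a(1)] unfolding a(2) by blast
  qed
qed

text \<open>Each section \<open>z \<mapsto> [s, z]\<close> is continuous. On a basic set \<open>[t, U]\<close> this holds because an
  equality of germs at \<open>z\<close> is witnessed by an idempotent \<open>e\<close>, and then persists on the open set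
  where \<open>e\<close> is defined.\<close>

lemma openin_germ_preimage:
  assumes op: "\<And>e. e \<in> idempotents \<Longrightarrow> openin Z (act_set \<theta> e)"
    and V: "openin (transformation_topology Z \<theta>) V"
  shows "openin Z {z \<in> act_set \<theta> (star s * s). germ \<theta> s z \<in> V}"
proof -
  let ?A = "act_set \<theta> (star s * s)"
  have A: "openin Z ?A"
    by (simp add: op)
  from V have "generate_topology_on {germ \<theta> s ` U | s U. openin Z U \<and> U \<subseteq> act_set \<theta> (star s * s)} V"
    unfolding transformation_topology_def by (rule openin_topology_generated_by)
  then show ?thesis
  proof induction
    case Empty
    show ?case by simp
  next
    case (Int a b)
    then have "openin Z ({z \<in> ?A. germ \<theta> s z \<in> a} \<inter> {z \<in> ?A. germ \<theta> s z \<in> b})"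
      by (simp add: openin_Int)
    moreover have "{z \<in> ?A. germ \<theta> s z \<in> a} \<inter> {z \<in> ?A. germ \<theta> s z \<in> b} = {z \<in> ?A. germ \<theta> s z \<in> a \<inter> b}"
      by blast
    ultimately show ?case by simp
  next
    case (UN K)
    have "{z \<in> ?A. germ \<theta> s z \<in> \<Union>K} = (\<Union>k\<in>K. {z \<in> ?A. germ \<theta> s z \<in> k})"
      by blast
    then show ?case
      using UN.IH by (simp only:) (rule openin_Union, blast)
  next
    case (Basis k)
    then obtain t U where k: "k = germ \<theta> t ` U" "openin Z U" "U \<subseteq> act_set \<theta> (star t * t)"
      by blast
    have "{z \<in> ?A. germ \<theta> s z \<in> k} = (\<Union>e\<in>{e \<in> idempotents. s * e = t * e}. U \<inter> ?A \<inter> act_set \<theta> e)"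
      (is "?L = ?R")
    proof (intro set_eqI iffI)
      fix z assume "z \<in> ?L"
      then obtain u where z: "z \<in> ?A" "u \<in> U" "germ \<theta> s z = germ \<theta> t u"
        unfolding k(1) by blast
      obtain v v' where v: "\<theta> s z = Some v" "\<theta> t u = Some v'"
        using z(1,2) k(3) unfolding subset_iff act_set_star_iff by blast
      obtain e where "z = u" "e \<in> idempotents" "s * e = t * e" "z \<in> act_set \<theta> e"
        by (rule germ_eqD[OF z(3) v])
      then show "z \<in> ?R"
        using z by blast
    next
      fix z assume "z \<in> ?R"
      then obtain e where e: "e \<in> idempotents" "s * e = t * e" "z \<in> U" "z \<in> ?A" "z \<in> act_set \<theta> e"
        by blast
      obtain v v' where "\<theta> s z = Some v" "\<theta> t z = Some v'"
        using e k(3) unfolding subset_iff act_set_star_iff by blast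
      then have "germ \<theta> s z = germ \<theta> t z"
        using e by (intro germ_eqI)
      then show "z \<in> ?L"
        using e unfolding k(1) by blast
    qed
    moreover have "openin Z ?R"
      by (rule openin_Union) (auto intro!: openin_Int A k op)
    ultimately show ?case by simp
  qed
qed

end

text \<open>All representatives of a germ have the same second component.\<close>

definition germ_base :: "('s \<times> 'z) set \<Rightarrow> 'z" where
  "germ_base a = snd (SOME p. p \<in> a)"

lemma (in partial_action) germ_base_germ:
  assumes "\<theta> s z = Some w"
  shows "germ_base (germ \<theta> s z) = z"
proof -
  have "(s, z) \<in> germ \<theta> s z"
    unfolding germ_def using equiv_class_self[OF equiv_germ_rel] assms germ_pairs_iff by blast
  then have "(SOME p. p \<in> germ \<theta> s z) \<in> germ \<theta> s z"
    by (rule someI)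
  then show ?thesis
    unfolding germ_base_def by (auto simp: germ_def germ_rel_def)
qed

lemma (in partial_action) continuous_map_germ_base:
  assumes "\<And>e. e \<in> idempotents \<Longrightarrow> openin Z (act_set \<theta> e)"
  shows "continuous_map (transformation_topology Z \<theta>) Z germ_base"
  unfolding continuous_map
proof (intro conjI allI impI)
  have top: "topspace (transformation_topology Z \<theta>) = arrows G"
    by (rule topspace_transformation_topology) (rule assms)
  have sub: "act_set \<theta> (star s * s) \<subseteq> topspace Z" for s
    using assms openin_subset by (metis star_mult_idempotent(1))
  show "germ_base ` topspace (transformation_topology Z \<theta>) \<subseteq> topspace Z"
  proof (rule image_subsetI)
    fix a assume "a \<in> topspace (transformation_topology Z \<theta>)"
    then obtain s z w where "\<theta> s z = Some w" "a = germ \<theta> s z"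
      unfolding top arrows_iff by blast
    then show "germ_base a \<in> topspace Z"
      using germ_base_germ act_set_source sub by fastforce
  qed
  fix U assume U: "openin Z U"
  have "{a \<in> arrows G. germ_base a \<in> U} = (\<Union>s. germ \<theta> s ` (U \<inter> act_set \<theta> (star s * s)))"
    (is "?L = ?R")
  proof (intro set_eqI iffI)
    fix a assume "a \<in> ?L"
    then obtain s z w where a: "\<theta> s z = Some w" "a = germ \<theta> s z" "germ_base a \<in> U"
      unfolding arrows_iff by blast
    then have "z \<in> U \<inter> act_set \<theta> (star s * s)"
      using germ_base_germ act_set_source by auto
    then show "a \<in> ?R"
      using a(2) by blast
  next
    fix a assume "a \<in> ?R"
    then obtain s z where a: "a = germ \<theta> s z" "z \<in> U" "z \<in> act_set \<theta> (star s * s)"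
      by blast
    then obtain w where "\<theta> s z = Some w"
      unfolding act_set_star_iff by blast
    then show "a \<in> ?L"
      using a germ_base_germ arrows_iff by auto
  qed
  moreover have "openin (transformation_topology Z \<theta>) ?R"
    by (rule openin_Union) (auto intro!: openin_germ_image openin_Int U assms)
  ultimately show "openin (transformation_topology Z \<theta>)
      {a \<in> topspace (transformation_topology Z \<theta>). germ_base a \<in> U}"
    unfolding top by simp
qed


section \<open>Borel sets\<close>

lemma space_borel_algebra: "space (borel_algebra T) = topspace T"
  by (simp add: borel_algebra_def space_measure_of_conv)

lemma openin_borel_algebra: "openin T U \<Longrightarrow> U \<in> sets (borel_algebra T)"
  unfolding borel_algebra_def
  by (subst sets_measure_of) (auto dest: openin_subset)

lemma borel_mapI:
  assumes "f ` topspace S \<subseteq> topspace T"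
    and "\<And>V. openin T V \<Longrightarrow> f -` V \<inter> topspace S \<in> sets (borel_algebra S)"
  shows "borel_map S T f"
  unfolding borel_map_def borel_algebra_def[of T]
  using assms by (intro measurable_measure_of) (auto simp: space_borel_algebra dest: openin_subset)

lemma borel_mapD:
  "borel_map S T f \<Longrightarrow> V \<in> sets (borel_algebra T) \<Longrightarrow> f -` V \<inter> topspace S \<in> sets (borel_algebra S)"
  unfolding borel_map_def using measurable_sets[of f "borel_algebra S" "borel_algebra T" V]
  by (simp add: space_borel_algebra)

lemma continuous_imp_borel_map:
  assumes "continuous_map S T f"
  shows "borel_map S T f"
proof (rule borel_mapI)
  show "f ` topspace S \<subseteq> topspace T"
    using assms by (simp add: continuous_map)
  fix V assume "openin T V"
  then have "openin S {x \<in> topspace S. f x \<in> V}"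
    using assms by (simp add: continuous_map)
  moreover have "{x \<in> topspace S. f x \<in> V} = f -` V \<inter> topspace S"
    by blast
  ultimately show "f -` V \<inter> topspace S \<in> sets (borel_algebra S)"
    using openin_borel_algebra by metis
qed


section \<open>Homomorphisms of germ groupoids induced by maps of spaces\<close>

text \<open>The hypothesis \<open>reflects\<close> turns equivariance into an equality \<open>\<rho> -` Z\<^sub>e = Y\<^sub>e\<close>. This is what
  makes the induced homomorphism \<open>d\<close>-bijective: a germ at \<open>\<rho> y\<close> exists exactly when the germ of the
  same semigroup element exists at \<open>y\<close>, and an idempotent that identifies two germs at \<open>\<rho> y\<close> already
  identifies them at \<open>y\<close>.\<close>

locale germ_map = \<sigma>: partial_action \<sigma> + \<kappa>: partial_action \<kappa>
  for \<sigma> :: "'s::inverse_semigroup \<Rightarrow> 'y \<rightharpoonup> 'y" and \<kappa> :: "'s \<Rightarrow> 'z \<rightharpoonup> 'z" +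
  fixes \<rho> :: "'y \<Rightarrow> 'z"
  assumes equiv: "\<sigma> s y = Some w \<Longrightarrow> \<kappa> s (\<rho> y) = Some (\<rho> w)"
    and reflects: "e \<in> idempotents \<Longrightarrow> \<rho> y \<in> act_set \<kappa> e \<Longrightarrow> y \<in> act_set \<sigma> e"
begin

abbreviation \<rho>' where "\<rho>' \<equiv> transformation_map \<sigma> \<kappa> \<rho>"

lemma act_set_vimage: "e \<in> idempotents \<Longrightarrow> \<rho> y \<in> act_set \<kappa> e \<longleftrightarrow> y \<in> act_set \<sigma> e"
  using equiv[of e y y] reflects[of e y] by (auto simp: act_set_def)

lemma germ_map_cong:
  assumes "\<sigma> s y = Some w" "\<sigma> t y' = Some w'" "germ \<sigma> s y = germ \<sigma> t y'"
  shows "germ \<kappa> s (\<rho> y) = germ \<kappa> t (\<rho> y')"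
proof -
  obtain e where e: "y = y'" "e \<in> idempotents" "s * e = t * e" "y \<in> act_set \<sigma> e"
    by (rule \<sigma>.germ_eqD[OF assms(3,1,2)])
  have "\<rho> y \<in> act_set \<kappa> e"
    using act_set_vimage e by blast
  then have "germ \<kappa> s (\<rho> y) = germ \<kappa> t (\<rho> y)"
    using e equiv assms(1,2) by (intro \<kappa>.germ_eqI[of s _ _ t _ e]) auto
  then show ?thesis
    using e(1) by simp
qed

lemma transformation_map_germ:
  assumes "\<sigma> s y = Some w"
  shows "\<rho>' (germ \<sigma> s y) = germ \<kappa> s (\<rho> y)"
  unfolding transformation_map_def
proof (rule the_equality)
  show "\<exists>s' y'. (s', y') \<in> germ_pairs \<sigma> \<and> germ \<sigma> s y = germ \<sigma> s' y' \<and> germ \<kappa> s (\<rho> y) = germ \<kappa> s' (\<rho> y')"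
    by (rule exI[of _ s], rule exI[of _ y]) (simp add: \<sigma>.germ_pairs_iff assms)
  fix b assume "\<exists>s' y'. (s', y') \<in> germ_pairs \<sigma> \<and> germ \<sigma> s y = germ \<sigma> s' y' \<and> b = germ \<kappa> s' (\<rho> y')"
  then obtain s' y' w' where "\<sigma> s' y' = Some w'" "germ \<sigma> s y = germ \<sigma> s' y'" "b = germ \<kappa> s' (\<rho> y')"
    unfolding \<sigma>.germ_pairs_iff by blast
  then show "b = germ \<kappa> s (\<rho> y)"
    using germ_map_cong[OF assms] by simp
qed

theorem groupoid_hom_transformation_map: "groupoid_hom \<sigma>.G \<kappa>.G \<rho>'"
  unfolding groupoid_hom_def
proof (intro conjI ballI impI \<sigma>.groupoid_transformation_groupoid \<kappa>.groupoid_transformation_groupoid)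
  show "\<rho>' \<in> arrows \<sigma>.G \<rightarrow> arrows \<kappa>.G"
  proof (rule funcsetI)
    fix a assume "a \<in> arrows \<sigma>.G"
    then obtain s y w where a: "\<sigma> s y = Some w" "a = germ \<sigma> s y"
      unfolding \<sigma>.arrows_iff by blast
    show "\<rho>' a \<in> arrows \<kappa>.G"
      unfolding a(2) transformation_map_germ[OF a(1)] \<kappa>.arrows_iff using equiv[OF a(1)] by blast
  qed
next
  fix a b assume "a \<in> arrows \<sigma>.G" "b \<in> arrows \<sigma>.G" and st: "source \<sigma>.G a = target \<sigma>.G b"
  then obtain s y w t y' v where ab: "\<sigma> s y = Some w" "b = germ \<sigma> s y" "\<sigma> t y' = Some v" "a = germ \<sigma> t y'"
    unfolding \<sigma>.arrows_iff by blast
  have y': "y' = w"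
    using st \<sigma>.source_eq_target_iff[OF ab(1,3)] ab by simp
  have t: "\<sigma> t w = Some v"
    using ab(3) y' by simp
  note \<rho>'_ab = transformation_map_germ[OF ab(1)] transformation_map_germ[OF t]
  have ts: "\<sigma> (t * s) y = Some v"
    using \<sigma>.mult_Some[OF ab(1)] t by simp
  show "source \<kappa>.G (\<rho>' a) = target \<kappa>.G (\<rho>' b)"
    unfolding ab(2,4) y' \<rho>'_ab \<kappa>.source_eq_target_iff[OF equiv[OF ab(1)] equiv[OF t]] ..
  show "\<rho>' (compose_arrows \<sigma>.G a b) = compose_arrows \<kappa>.G (\<rho>' a) (\<rho>' b)"
    unfolding ab(2,4) y' \<rho>'_ab \<sigma>.compose_germ[OF ab(1) t] transformation_map_germ[OF ts]
      \<kappa>.compose_germ[OF equiv[OF ab(1)] equiv[OF t]] ..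
qed

lemma germ_map_inj:
  assumes "\<sigma> s y = Some w" "\<sigma> t y = Some w'" "germ \<kappa> s (\<rho> y) = germ \<kappa> t (\<rho> y)"
  shows "germ \<sigma> s y = germ \<sigma> t y"
proof -
  obtain e where e: "e \<in> idempotents" "s * e = t * e" "\<rho> y \<in> act_set \<kappa> e"
    by (rule \<kappa>.germ_eqD[OF assms(3) equiv[OF assms(1)] equiv[OF assms(2)]])
  then show ?thesis
    using assms reflects by (intro \<sigma>.germ_eqI[of s y _ t _ e]) auto
qed

lemma germ_map_lift:
  assumes "\<kappa> s (\<rho> y) = Some v"
  obtains w where "\<sigma> s y = Some w"
  using reflects[OF _ \<kappa>.act_set_source[OF assms]] \<sigma>.act_set_star_iff that by blast

theorem d_bijective_transformation_map: "d_bijective \<sigma>.G \<kappa>.G \<rho>'"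
  unfolding d_bijective_def
proof
  fix x assume "x \<in> units \<sigma>.G"
  then obtain e y where x: "e \<in> idempotents" "y \<in> act_set \<sigma> e" "x = germ \<sigma> e y"
    unfolding \<sigma>.units_iff by blast
  have \<rho>y: "\<rho> y \<in> act_set \<kappa> e"
    using act_set_vimage x by blast
  have \<rho>'_x: "\<rho>' x = germ \<kappa> e (\<rho> y)"
    using x transformation_map_germ by (simp add: act_set_def)
  show "bij_betw \<rho>' (source_fibre \<sigma>.G x) (source_fibre \<kappa>.G (\<rho>' x))"
    unfolding \<rho>'_x unfolding x(3) \<sigma>.source_fibre_germ[OF x(1,2)] \<kappa>.source_fibre_germ[OF x(1) \<rho>y]
  proof (rule bij_betw_imageI)
    show "inj_on \<rho>' {germ \<sigma> s y | s. \<exists>w. \<sigma> s y = Some w}"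
      by (rule inj_onI, clarify) (metis germ_map_inj transformation_map_germ)
    show "\<rho>' ` {germ \<sigma> s y | s. \<exists>w. \<sigma> s y = Some w} = {germ \<kappa> s (\<rho> y) | s. \<exists>w. \<kappa> s (\<rho> y) = Some w}"
    proof (intro equalityI subsetI)
      fix b assume "b \<in> \<rho>' ` {germ \<sigma> s y | s. \<exists>w. \<sigma> s y = Some w}"
      then obtain s w where "\<sigma> s y = Some w" "b = \<rho>' (germ \<sigma> s y)"
        by blast
      then show "b \<in> {germ \<kappa> s (\<rho> y) | s. \<exists>w. \<kappa> s (\<rho> y) = Some w}"
        using transformation_map_germ[of s y w] equiv[of s y w] by blast
    next
      fix b assume "b \<in> {germ \<kappa> s (\<rho> y) | s. \<exists>w. \<kappa> s (\<rho> y) = Some w}"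
      then obtain s v where b: "b = germ \<kappa> s (\<rho> y)" "\<kappa> s (\<rho> y) = Some v"
        by blast
      obtain w where w: "\<sigma> s y = Some w"
        by (rule germ_map_lift[OF b(2)])
      show "b \<in> \<rho>' ` {germ \<sigma> s y | s. \<exists>w. \<sigma> s y = Some w}"
        using w transformation_map_germ[OF w] unfolding b(1) by blast
    qed
  qed
qed

text \<open>By \<open>d\<close>-bijectivity the preimage of a set of germs of \<open>s\<close> consists of germs of \<open>s\<close>, so
  continuity and measurability of \<open>\<rho>'\<close> reduce to those of \<open>\<rho>\<close>.\<close>

lemma transformation_map_vimage_germ:
  assumes "V \<subseteq> act_set \<kappa> (star s * s)"
  shows "\<rho>' -` (germ \<kappa> s ` V) \<inter> arrows \<sigma>.G = germ \<sigma> s ` (\<rho> -` V)" (is "?L = ?R")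
proof (intro equalityI subsetI)
  fix a assume "a \<in> ?L"
  then have "a \<in> arrows \<sigma>.G" "\<rho>' a \<in> germ \<kappa> s ` V"
    by simp_all
  then obtain t y w v where a: "\<sigma> t y = Some w" "a = germ \<sigma> t y" "\<rho>' a = germ \<kappa> s v" "v \<in> V"
    unfolding \<sigma>.arrows_iff by blast
  have eq: "germ \<kappa> t (\<rho> y) = germ \<kappa> s v"
    using transformation_map_germ[OF a(1)] a(2,3) by simp
  obtain u where u: "\<kappa> s v = Some u"
    using assms a(4) unfolding subset_iff \<kappa>.act_set_star_iff by blast
  have v: "v = \<rho> y"
    using \<kappa>.germ_eq_endpoints(1)[OF eq equiv[OF a(1)] u] by simp
  obtain w' where "\<sigma> s y = Some w'"
    using germ_map_lift u unfolding v by blast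
  then have "a = germ \<sigma> s y"
    using germ_map_inj a(1,2) eq unfolding v by blast
  then show "a \<in> ?R"
    using a(4) v by blast
next
  fix a assume "a \<in> ?R"
  then obtain y where y: "a = germ \<sigma> s y" "\<rho> y \<in> V"
    by blast
  then obtain v where "\<kappa> s (\<rho> y) = Some v"
    using assms unfolding subset_iff \<kappa>.act_set_star_iff by blast
  then obtain w where w: "\<sigma> s y = Some w"
    by (rule germ_map_lift)
  have "a \<in> arrows \<sigma>.G"
    using w y(1) unfolding \<sigma>.arrows_iff by blast
  then show "a \<in> ?L"
    using y(2) transformation_map_germ[OF w] unfolding y(1) by blast
qed

lemma vimage_subset_act_set:
  "V \<subseteq> act_set \<kappa> (star s * s) \<Longrightarrow> \<rho> -` V \<subseteq> act_set \<sigma> (star s * s)"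
  using reflects[of "star s * s"] by auto

context
  fixes Y :: "'y topology" and Z :: "'z topology"
  assumes Y_open: "e \<in> idempotents \<Longrightarrow> openin Y (act_set \<sigma> e)"
    and Z_open: "e \<in> idempotents \<Longrightarrow> openin Z (act_set \<kappa> e)"
begin

lemma topspace_Y: "topspace (transformation_topology Y \<sigma>) = arrows \<sigma>.G"
  by (rule \<sigma>.topspace_transformation_topology) (rule Y_open)

lemma topspace_Z: "topspace (transformation_topology Z \<kappa>) = arrows \<kappa>.G"
  by (rule \<kappa>.topspace_transformation_topology) (rule Z_open)

lemma vimage_subset_topspace:
  assumes "V \<subseteq> act_set \<kappa> (star s * s)"
  shows "\<rho> -` V \<inter> topspace Y = \<rho> -` V"
  using vimage_subset_act_set[OF assms] openin_subset[OF Y_open[of "star s * s"]] by auto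

lemma transformation_map_image:
  "\<rho>' ` topspace (transformation_topology Y \<sigma>) \<subseteq> topspace (transformation_topology Z \<kappa>)"
  using groupoid_hom_transformation_map unfolding topspace_Y topspace_Z groupoid_hom_def by blast

theorem continuous_transformation_map:
  assumes "continuous_map Y Z \<rho>"
  shows "continuous_map (transformation_topology Y \<sigma>) (transformation_topology Z \<kappa>) \<rho>'"
  unfolding transformation_topology_def[of Z]
proof (rule continuous_on_generated_topo)
  show "\<rho>' ` topspace (transformation_topology Y \<sigma>)
      \<subseteq> \<Union> {germ \<kappa> s ` U | s U. openin Z U \<and> U \<subseteq> act_set \<kappa> (star s * s)}"
    using transformation_map_image
    unfolding transformation_topology_def[of Z] topology_generated_by_topspace .
  fix W assume "W \<in> {germ \<kappa> s ` U | s U. openin Z U \<and> U \<subseteq> act_set \<kappa> (star s * s)}"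
  then obtain s U where W: "W = germ \<kappa> s ` U" "openin Z U" "U \<subseteq> act_set \<kappa> (star s * s)"
    by blast
  have "{y \<in> topspace Y. \<rho> y \<in> U} = \<rho> -` U"
    using vimage_subset_topspace[OF W(3)] by blast
  then have "openin Y (\<rho> -` U)"
    using openin_continuous_map_preimage[OF assms W(2)] by simp
  then show "openin (transformation_topology Y \<sigma>) (\<rho>' -` W \<inter> topspace (transformation_topology Y \<sigma>))"
    unfolding topspace_Y W(1) transformation_map_vimage_germ[OF W(3)]
    by (rule \<sigma>.openin_germ_image) (rule vimage_subset_act_set[OF W(3)])
qed

text \<open>The sections \<open>y \<mapsto> [s, y]\<close> are homeomorphisms onto open sets, with inverse \<open>germ_base\<close>.\<close>

lemma germ_image_borel:
  assumes "B \<in> sets (borel_algebra Y)" "B \<subseteq> act_set \<sigma> (star s * s)"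
  shows "germ \<sigma> s ` B \<in> sets (borel_algebra (transformation_topology Y \<sigma>))"
proof -
  let ?T = "transformation_topology Y \<sigma>"
  have "germ \<sigma> s ` B = germ \<sigma> s ` act_set \<sigma> (star s * s) \<inter> (germ_base -` B \<inter> topspace ?T)" (is "_ = ?R")
  proof (intro equalityI subsetI)
    fix a assume "a \<in> germ \<sigma> s ` B"
    then obtain y where y: "a = germ \<sigma> s y" "y \<in> B" by blast
    then have y': "y \<in> act_set \<sigma> (star s * s)"
      using assms(2) by blast
    then obtain w where "\<sigma> s y = Some w"
      unfolding \<sigma>.act_set_star_iff by blast
    then have "germ_base a = y" "a \<in> topspace ?T"
      unfolding topspace_Y y(1) \<sigma>.arrows_iff by (blast intro: \<sigma>.germ_base_germ)+
    then show "a \<in> ?R"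
      using y y' by blast
  next
    fix a assume "a \<in> ?R"
    then obtain y where y: "a = germ \<sigma> s y" "y \<in> act_set \<sigma> (star s * s)" "germ_base a \<in> B" by blast
    then obtain w where "\<sigma> s y = Some w"
      unfolding \<sigma>.act_set_star_iff by blast
    then show "a \<in> germ \<sigma> s ` B"
      using y \<sigma>.germ_base_germ by force
  qed
  moreover have "germ_base -` B \<inter> topspace ?T \<in> sets (borel_algebra ?T)"
    by (intro borel_mapD[OF continuous_imp_borel_map[OF \<sigma>.continuous_map_germ_base] assms(1)] Y_open)
  moreover have "germ \<sigma> s ` act_set \<sigma> (star s * s) \<in> sets (borel_algebra ?T)"
    by (intro openin_borel_algebra \<sigma>.openin_germ_image Y_open) auto
  ultimately show ?thesis
    by simp
qed

text \<open>An open set of germs is the union over \<open>s\<close> of its parts \<open>[s, U\<^sub>s]\<close> with \<open>U\<^sub>s\<close> open. Only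
  those \<open>s\<close> with nonempty domain contribute, so countably many.\<close>

theorem borel_transformation_map:
  assumes "borel_map Y Z \<rho>" and countable: "countable {s. act_set \<kappa> (star s * s) \<noteq> {}}"
  shows "borel_map (transformation_topology Y \<sigma>) (transformation_topology Z \<kappa>) \<rho>'"
proof (rule borel_mapI[OF transformation_map_image])
  fix V assume V: "openin (transformation_topology Z \<kappa>) V"
  define C where "C = {s. act_set \<kappa> (star s * s) \<noteq> {}}"
  define U where "U s = {z \<in> act_set \<kappa> (star s * s). germ \<kappa> s z \<in> V}" for s
  have U: "openin Z (U s)" "U s \<subseteq> act_set \<kappa> (star s * s)" for s
    unfolding U_def using \<kappa>.openin_germ_preimage[OF Z_open V] by auto
  have "V = (\<Union>s\<in>C. germ \<kappa> s ` U s)"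
  proof (intro equalityI subsetI)
    fix a assume "a \<in> V"
    then obtain s z w where a: "\<kappa> s z = Some w" "a = germ \<kappa> s z"
      using openin_subset[OF V] unfolding topspace_Z subset_iff \<kappa>.arrows_iff by blast
    then have "z \<in> U s"
      using \<open>a \<in> V\<close> \<kappa>.act_set_source[OF a(1)] unfolding U_def by simp
    moreover from this have "s \<in> C"
      unfolding U_def C_def by blast
    ultimately show "a \<in> (\<Union>s\<in>C. germ \<kappa> s ` U s)"
      using a(2) by blast
  qed (auto simp: U_def)
  then have "\<rho>' -` V \<inter> topspace (transformation_topology Y \<sigma>)
      = (\<Union>s\<in>C. \<rho>' -` (germ \<kappa> s ` U s) \<inter> arrows \<sigma>.G)"
    unfolding topspace_Y by blast
  also have "\<dots> = (\<Union>s\<in>C. germ \<sigma> s ` (\<rho> -` U s))"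
    using transformation_map_vimage_germ[OF U(2)] by simp
  also have "\<dots> \<in> sets (borel_algebra (transformation_topology Y \<sigma>))"
  proof (rule sets.countable_UN'[OF countable[folded C_def]], rule image_subsetI)
    fix s
    have "\<rho> -` U s \<inter> topspace Y \<in> sets (borel_algebra Y)"
      by (rule borel_mapD[OF assms(1) openin_borel_algebra[OF U(1)]])
    then show "germ \<sigma> s ` (\<rho> -` U s) \<in> sets (borel_algebra (transformation_topology Y \<sigma>))"
      unfolding vimage_subset_topspace[OF U(2)]
      by (rule germ_image_borel) (rule vimage_subset_act_set[OF U(2)])
  qed
  finally show "\<rho>' -` V \<inter> topspace (transformation_topology Y \<sigma>)
      \<in> sets (borel_algebra (transformation_topology Y \<sigma>))" .
qed

end

end


section \<open>Points of the space $X^{\mathrm{KS}}$ as filters\<close>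

text \<open>All finite coordinates of an element of $X^{\mathrm{KS}}$ agree, so the element amounts to a
  point \<open>x\<close> and the set of idempotents at which it is finite. That set is a filter of idempotents
  whose domains contain \<open>x\<close>. In these terms the action moves \<open>x\<close> by \<open>\<theta>\<close> and conjugates the
  filter.\<close>

definition KS_point :: "'x \<Rightarrow> 's::inverse_semigroup set \<Rightarrow> 's \<Rightarrow> 'x option" where
  "KS_point x F = (\<lambda>e\<in>idempotents. if e \<in> F then Some x else None)"

definition domain_filter :: "('s::inverse_semigroup \<Rightarrow> 'x \<rightharpoonup> 'x) \<Rightarrow> 'x \<Rightarrow> 's set \<Rightarrow> bool" where
  "domain_filter \<theta> x F \<longleftrightarrow>
     F \<subseteq> idempotents \<and> F \<noteq> {} \<and> (\<forall>e\<in>F. \<forall>f\<in>F. e * f \<in> F) \<and>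
     (\<forall>e\<in>F. \<forall>f\<in>idempotents. f * e = e \<longrightarrow> f \<in> F) \<and> (\<forall>e\<in>F. x \<in> act_set \<theta> e)"

lemma domain_filterD:
  assumes "domain_filter \<theta> x F"
  shows "F \<subseteq> idempotents" "F \<noteq> {}"
    and "e \<in> F \<Longrightarrow> f \<in> F \<Longrightarrow> e * f \<in> F"
    and "e \<in> F \<Longrightarrow> f \<in> idempotents \<Longrightarrow> f * e = e \<Longrightarrow> f \<in> F"
    and "e \<in> F \<Longrightarrow> x \<in> act_set \<theta> e"
  using assms unfolding domain_filter_def by blast+

lemma domain_filter_mult_iff:
  assumes "domain_filter \<theta> x F" "e \<in> idempotents" "f \<in> idempotents"
  shows "e * f \<in> F \<longleftrightarrow> e \<in> F \<and> f \<in> F"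
proof
  assume ef: "e * f \<in> F"
  have "e * (e * f) = e * f" "f * (f * e) = f * e"
    using assms by (simp_all add: idempotent_square)
  then have "e * (e * f) = e * f" "f * (e * f) = e * f"
    using idempotents_commute[OF assms(2,3)] by simp_all
  then show "e \<in> F \<and> f \<in> F"
    using domain_filterD(4)[OF assms(1) ef] assms(2,3) by blast
qed (use domain_filterD(3)[OF assms(1)] in blast)

lemma KS_point_apply: "e \<in> idempotents \<Longrightarrow> KS_point x F e = (if e \<in> F then Some x else None)"
  by (simp add: KS_point_def)

lemma KS_point_eqD:
  assumes "KS_point x F = KS_point x' F'" "domain_filter \<theta> x F" "domain_filter \<theta> x' F'"
  shows "x = x'" "F = F'"
proof -
  have eq: "(if e \<in> F then Some x else None) = (if e \<in> F' then Some x' else None)"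
    if "e \<in> idempotents" for e
    using fun_cong[OF assms(1), of e] that by (simp add: KS_point_apply)
  show F: "F = F'"
  proof (rule set_eqI)
    fix e
    show "e \<in> F \<longleftrightarrow> e \<in> F'"
      using eq[of e] domain_filterD(1)[OF assms(2)] domain_filterD(1)[OF assms(3)]
      by (cases "e \<in> idempotents") (auto split: if_splits)
  qed
  obtain e where "e \<in> F"
    using domain_filterD(2)[OF assms(2)] by blast
  then show "x = x'"
    using eq[of e] domain_filterD(1)[OF assms(2)] F by auto
qed

locale topological_action = partial_action \<theta>
  for \<theta> :: "'s::inverse_semigroup \<Rightarrow> 'x \<rightharpoonup> 'x" +
  fixes X :: "'x topology"
  assumes openin_act_set: "e \<in> idempotents \<Longrightarrow> openin X (act_set \<theta> e)"
    and act_sets_cover: "(\<Union>e\<in>idempotents. act_set \<theta> e) = topspace X"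

lemma isg_action_topological_action: "isg_action X \<theta> \<Longrightarrow> topological_action \<theta> X"
  by (auto simp: isg_action_partial_action topological_action_def topological_action_axioms_def)
    (auto simp: isg_action_def)

context topological_action
begin

lemma topspace_Int_act_set [simp]: "e \<in> idempotents \<Longrightarrow> topspace X \<inter> act_set \<theta> e = act_set \<theta> e"
  using openin_subset[OF openin_act_set] by blast

lemma topspace_KS_product:
  "topspace (KS_product X \<theta>) = (\<Pi>\<^sub>E e\<in>idempotents. insert None (Some ` act_set \<theta> e))"
  by (auto simp: KS_product_def intro!: PiE_cong)

lemma topspace_KS_space: "topspace (KS_space X \<theta>) = KS_tilde X \<theta> - {KS_infinity}"
  unfolding KS_space_def topspace_subtopology by (auto simp: KS_tilde_def)

lemma KS_point_in_KS_space:
  assumes F: "domain_filter \<theta> x F"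
  shows "KS_point x F \<in> topspace (KS_space X \<theta>)"
proof -
  note FD = domain_filterD[OF F]
  have "KS_point x F \<in> topspace (KS_product X \<theta>)"
    unfolding topspace_KS_product using FD(5) by (auto simp: KS_point_def)
  moreover have "KS_point x F e2 = KS_point x F e1"
    if "e1 \<in> idempotents" "e2 \<in> idempotents" "isg_le e1 e2" "KS_point x F e1 \<noteq> None" for e1 e2
  proof -
    have "e1 \<in> F"
      using that by (simp add: KS_point_apply split: if_splits)
    then show ?thesis
      using FD(4)[of e1 e2] that by (simp add: KS_point_apply idempotents_le_iff)
  qed
  moreover have "KS_point x F (e1 * e2) \<noteq> None"
    if "e1 \<in> idempotents" "e2 \<in> idempotents" "KS_point x F e1 \<noteq> None" "KS_point x F e2 \<noteq> None" for e1 e2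
    using that FD(3)[of e1 e2] by (simp add: KS_point_apply idempotents_mult split: if_splits)
  moreover have "KS_point x F \<noteq> KS_infinity"
  proof -
    obtain e where "e \<in> F" using FD(2) by blast
    then have "KS_point x F e \<noteq> KS_infinity e"
      using FD(1) by (auto simp: KS_point_def KS_infinity_def)
    then show ?thesis by auto
  qed
  ultimately show ?thesis
    unfolding topspace_KS_space KS_tilde_def by blast
qed

lemma KS_space_cases:
  assumes "\<tau> \<in> topspace (KS_space X \<theta>)"
  obtains x F where "\<tau> = KS_point x F" "domain_filter \<theta> x F"
proof -
  have prod: "\<tau> \<in> (\<Pi>\<^sub>E e\<in>idempotents. insert None (Some ` act_set \<theta> e))"
    and up: "\<And>e1 e2. e1 \<in> idempotents \<Longrightarrow> e2 \<in> idempotents \<Longrightarrow> e2 * e1 = e1 \<Longrightarrow> \<tau> e1 \<noteq> None \<Longrightarrow> \<tau> e2 = \<tau> e1"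
    and meet: "\<And>e1 e2. e1 \<in> idempotents \<Longrightarrow> e2 \<in> idempotents \<Longrightarrow> \<tau> e1 \<noteq> None \<Longrightarrow> \<tau> e2 \<noteq> None \<Longrightarrow> \<tau> (e1 * e2) \<noteq> None"
    and nontriv: "\<tau> \<noteq> KS_infinity"
    using assms idempotents_le_iff unfolding topspace_KS_space KS_tilde_def topspace_KS_product
    by blast+
  define F where "F = {e \<in> idempotents. \<tau> e \<noteq> None}"
  have "F \<noteq> {}"
  proof
    assume "F = {}"
    then have "\<tau> = KS_infinity"
      using prod unfolding F_def KS_infinity_def by (intro extensionalityI[of _ idempotents]) (auto simp: PiE_iff)
    with nontriv show False ..
  qed
  then obtain e0 x where e0: "e0 \<in> idempotents" "\<tau> e0 = Some x"
    unfolding F_def by auto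
  \<comment> \<open>Two finite coordinates agree because both agree with the one at the product.\<close>
  have x: "\<tau> e = Some x" if e: "e \<in> F" for e
  proof -
    have "e \<in> idempotents" "\<tau> (e * e0) \<noteq> None"
      using e e0 meet[of e e0] unfolding F_def by auto
    moreover have "e * (e * e0) = e * e0" "e0 * (e0 * e) = e0 * e"
      using \<open>e \<in> idempotents\<close> e0(1) by (simp_all add: idempotent_square)
    moreover have "e0 * e = e * e0"
      by (rule idempotents_commute) fact+
    ultimately show ?thesis
      using up[of "e * e0" e] up[of "e * e0" e0] e0 idempotents_mult[of e e0] by simp
  qed
  have "\<tau> = KS_point x F"
  proof (rule extensionalityI[of _ idempotents])
    fix e :: 's assume e: "e \<in> idempotents"
    show "\<tau> e = KS_point x F e"
    proof (cases "e \<in> F")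
      case True
      then show ?thesis using x e by (simp add: KS_point_apply)
    next
      case False
      then show ?thesis using e by (simp add: F_def KS_point_apply)
    qed
  qed (use prod in \<open>auto simp: PiE_iff KS_point_def\<close>)
  moreover have "domain_filter \<theta> x F"
    unfolding domain_filter_def
  proof (intro conjI ballI impI)
    show "F \<noteq> {}" by fact
    show "F \<subseteq> idempotents"
      unfolding F_def by blast
    show "e * f \<in> F" if "e \<in> F" "f \<in> F" for e f
      using that meet[of e f] idempotents_mult[of e f] unfolding F_def by simp
    show "f \<in> F" if "e \<in> F" "f \<in> idempotents" "f * e = e" for e f
      using that up[of e f] unfolding F_def by simp
    show "x \<in> act_set \<theta> e" if "e \<in> F" for e
      using that x[of e] prod unfolding F_def by (auto simp: PiE_iff)
  qed
  ultimately show thesis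
    by (rule that)
qed

definition push_filter :: "'s \<Rightarrow> 's set \<Rightarrow> 's set" where
  "push_filter s F = {e \<in> idempotents. star s * e * s \<in> F}"

lemma domain_filter_push:
  assumes F: "domain_filter \<theta> x F" and s: "star s * s \<in> F" "\<theta> s x = Some w"
  shows "domain_filter \<theta> w (push_filter s F)"
proof -
  note FD = domain_filterD[OF F]
  have conj_mult: "star s * e * s * (star s * f * s) = star s * (e * f) * s" if "f \<in> idempotents" for e f
  proof -
    have "star s * e * s * (star s * f * s) = star s * e * (s * star s * f * s)"
      by (simp add: mult.assoc)
    then show ?thesis
      unfolding idempotent_conjugate(1)[OF that] by (simp add: mult.assoc)
  qed
  show ?thesis
    unfolding domain_filter_def push_filter_def
  proof (intro conjI ballI impI)
    have "s * star s \<in> {e \<in> idempotents. star s * e * s \<in> F}"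
      using s(1) by (simp add: mult.assoc star_cancel)
    then show "{e \<in> idempotents. star s * e * s \<in> F} \<noteq> {}"
      by blast
    show "e * f \<in> {e \<in> idempotents. star s * e * s \<in> F}"
      if "e \<in> {e \<in> idempotents. star s * e * s \<in> F}" "f \<in> {e \<in> idempotents. star s * e * s \<in> F}" for e f
      using that FD(3)[of "star s * e * s" "star s * f * s"] conj_mult[of f e] idempotents_mult[of e f]
      by simp
    show "f \<in> {e \<in> idempotents. star s * e * s \<in> F}"
      if "e \<in> {e \<in> idempotents. star s * e * s \<in> F}" "f \<in> idempotents" "f * e = e" for e f
      using that FD(4)[of "star s * e * s" "star s * f * s"] conj_mult[of e f]
        idempotent_conjugate(2)[of f s] by simp
    show "w \<in> act_set \<theta> e" if "e \<in> {e \<in> idempotents. star s * e * s \<in> F}" for e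
      using that FD(5)[of "star s * e * s"] act_set_conjugate[OF _ s(2), of e] by simp
  qed blast
qed

lemma KS_action_point:
  assumes F: "domain_filter \<theta> x F"
  shows "KS_action X \<theta> s (KS_point x F) =
    (if star s * s \<in> F then Some (KS_point (the (\<theta> s x)) (push_filter s F)) else None)"
proof (cases "star s * s \<in> F")
  case False
  then show ?thesis
    by (simp add: KS_action_def KS_point_apply)
next
  case True
  then obtain w where w: "\<theta> s x = Some w"
    using domain_filterD(5)[OF F] act_set_star_iff by blast
  have "(\<lambda>e\<in>idempotents. case KS_point x F (star s * e * s) of None \<Rightarrow> None
        | Some x \<Rightarrow> Some (the (\<theta> (e * s) x))) = KS_point w (push_filter s F)"
  proof (rule extensionalityI[of _ idempotents])
    fix e :: 's assume e: "e \<in> idempotents"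
    show "(\<lambda>e\<in>idempotents. case KS_point x F (star s * e * s) of None \<Rightarrow> None
        | Some x \<Rightarrow> Some (the (\<theta> (e * s) x))) e = KS_point w (push_filter s F) e"
    proof (cases "star s * e * s \<in> F")
      case False
      then show ?thesis
        using e by (simp add: KS_point_apply idempotent_conjugate(2) push_filter_def)
    next
      case True
      then have "w \<in> act_set \<theta> e"
        using domain_filterD(5)[OF F True] act_set_conjugate[OF e w] by simp
      then have "\<theta> (e * s) x = Some w"
        using mult_Some[OF w, of e] by (simp add: act_set_def)
      then show ?thesis
        using e True by (simp add: KS_point_apply idempotent_conjugate(2) push_filter_def)
    qed
  qed (simp_all add: KS_point_def)
  then show ?thesis
    using True w KS_point_in_KS_space[OF F] by (simp add: KS_action_def KS_point_apply)
qed

lemma KS_action_outside: "\<tau> \<notin> topspace (KS_space X \<theta>) \<Longrightarrow> KS_action X \<theta> s \<tau> = None"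
  by (simp add: KS_action_def)

lemma KS_action_mult: "KS_action X \<theta> (s * t) = KS_action X \<theta> s \<circ>\<^sub>m KS_action X \<theta> t"
proof
  fix \<tau>
  show "KS_action X \<theta> (s * t) \<tau> = (KS_action X \<theta> s \<circ>\<^sub>m KS_action X \<theta> t) \<tau>"
  proof (cases "\<tau> \<in> topspace (KS_space X \<theta>)")
    case False
    then show ?thesis by (simp add: KS_action_outside)
  next
    case True
    then obtain x F where \<tau>: "\<tau> = KS_point x F" and F: "domain_filter \<theta> x F"
      by (rule KS_space_cases)
    have st: "star (s * t) * e * (s * t) = star t * (star s * e * s) * t" for e
      by (simp add: star_mult mult.assoc)
    have dom_st: "star (s * t) * (s * t) = star t * (star s * s) * t"
      by (simp add: star_mult mult.assoc)
    show ?thesis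
    proof (cases "star t * t \<in> F")
      case False
      have "star t * t * (star t * (star s * s) * t) = star t * (star s * s) * t"
        by (simp add: mult.assoc star_cancel)
      then have "star t * (star s * s) * t \<notin> F"
        using domain_filterD(4)[OF F, of "star t * (star s * s) * t" "star t * t"] False by auto
      then show ?thesis
        using False unfolding \<tau> by (simp add: KS_action_point[OF F] dom_st)
    next
      case True
      then obtain w where w: "\<theta> t x = Some w"
        using domain_filterD(5)[OF F] act_set_star_iff by blast
      note F' = domain_filter_push[OF F True w]
      have "push_filter s (push_filter t F) = push_filter (s * t) F"
        unfolding push_filter_def st by (auto simp: idempotent_conjugate(2))
      moreover have "star s * s \<in> push_filter t F \<longleftrightarrow> star (s * t) * (s * t) \<in> F"
        unfolding push_filter_def dom_st by simp
      ultimately show ?thesis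
        using True w unfolding \<tau>
        by (simp add: KS_action_point[OF F] KS_action_point[OF F'] mult_Some)
    qed
  qed
qed

text \<open>The filter can be recovered from its image: if \<open>star s * s \<in> F\<close>, then \<open>e \<in> F\<close> holds exactly
  when \<open>s * e * star s\<close> lies in the pushed filter.\<close>

lemma push_filter_inj:
  assumes F: "domain_filter \<theta> x F" and s: "star s * s \<in> F" and e: "e \<in> idempotents"
  shows "s * e * star s \<in> push_filter s F \<longleftrightarrow> e \<in> F"
proof -
  have "star s * (s * e * star s) * s = star s * s * (e * (star s * s))"
    by (simp add: mult.assoc)
  moreover have "s * e * star s \<in> idempotents"
    using idempotent_conjugate(2)[OF e, of "star s"] by simp
  ultimately show ?thesis
    using s e unfolding push_filter_def
    by (simp add: domain_filter_mult_iff[OF F] idempotents_mult)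
qed

sublocale KS: partial_action "KS_action X \<theta>"
proof
  show "KS_action X \<theta> (s * t) = KS_action X \<theta> s \<circ>\<^sub>m KS_action X \<theta> t" for s t
    by (rule KS_action_mult)
  show "inj_on (KS_action X \<theta> s) (dom (KS_action X \<theta> s))" for s
  proof (rule inj_onI)
    fix \<tau> \<tau>'
    assume dom: "\<tau> \<in> dom (KS_action X \<theta> s)" "\<tau>' \<in> dom (KS_action X \<theta> s)"
      and eq: "KS_action X \<theta> s \<tau> = KS_action X \<theta> s \<tau>'"
    have "\<tau> \<in> topspace (KS_space X \<theta>)" "\<tau>' \<in> topspace (KS_space X \<theta>)"
      using dom by (auto simp: dom_def KS_action_def split: if_splits)
    then obtain x F x' F' where \<tau>: "\<tau> = KS_point x F" "domain_filter \<theta> x F"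
      and \<tau>': "\<tau>' = KS_point x' F'" "domain_filter \<theta> x' F'"
      by (elim KS_space_cases)
    have s: "star s * s \<in> F" "star s * s \<in> F'"
      using dom unfolding \<tau>(1) \<tau>'(1)
      by (auto simp: dom_def KS_action_point[OF \<tau>(2)] KS_action_point[OF \<tau>'(2)] split: if_splits)
    obtain w w' where w: "\<theta> s x = Some w" "\<theta> s x' = Some w'"
      using s domain_filterD(5)[OF \<tau>(2)] domain_filterD(5)[OF \<tau>'(2)] act_set_star_iff by blast
    have "KS_point w (push_filter s F) = KS_point w' (push_filter s F')"
      using eq s w unfolding \<tau>(1) \<tau>'(1)
      by (simp add: KS_action_point[OF \<tau>(2)] KS_action_point[OF \<tau>'(2)])
    then have ww: "w = w'" "push_filter s F = push_filter s F'"
      using KS_point_eqD[OF _ domain_filter_push[OF \<tau>(2) s(1) w(1)] domain_filter_push[OF \<tau>'(2) s(2) w(2)]]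
      by blast+
    then have "x = x'"
      using inj_onD[OF inj[of s], of x x'] w by (simp add: dom_def)
    moreover have "F = F'"
    proof (rule set_eqI)
      fix e show "e \<in> F \<longleftrightarrow> e \<in> F'"
        using push_filter_inj[OF \<tau>(2) s(1), of e] push_filter_inj[OF \<tau>'(2) s(2), of e] ww(2)
          domain_filterD(1)[OF \<tau>(2)] domain_filterD(1)[OF \<tau>'(2)] by blast
    qed
    ultimately show "\<tau> = \<tau>'"
      unfolding \<tau>(1) \<tau>'(1) by simp
  qed
qed

lemma act_set_KS:
  assumes "e \<in> idempotents"
  shows "act_set (KS_action X \<theta>) e = {\<tau> \<in> topspace (KS_space X \<theta>). \<tau> e \<noteq> None}"
proof -
  have "star e * e = e"
    using assms by (simp add: star_idempotent idempotent_square)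
  then show ?thesis
    by (auto simp: KS.act_set_iff[OF assms] KS_action_def split: if_splits)
qed

lemma act_set_KS_nonempty:
  assumes "act_set (KS_action X \<theta>) e \<noteq> {}" "e \<in> idempotents"
  shows "act_set \<theta> e \<noteq> {}"
proof -
  obtain \<tau> where \<tau>: "\<tau> \<in> topspace (KS_space X \<theta>)" "\<tau> e \<noteq> None"
    using assms by (auto simp: act_set_KS)
  from \<tau>(1) obtain x F where "\<tau> = KS_point x F" "domain_filter \<theta> x F"
    by (rule KS_space_cases)
  then show ?thesis
    using \<tau>(2) assms(2) domain_filterD(5)[of \<theta> x F e] by (auto simp: KS_point_apply split: if_splits)
qed

lemma openin_act_set_KS:
  assumes e: "e \<in> idempotents"
  shows "openin (KS_space X \<theta>) (act_set (KS_action X \<theta>) e)"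
proof -
  let ?Xe = "Alexandroff_compactification (subtopology X (act_set \<theta> e))"
  have "openin (KS_product X \<theta>) {\<tau> \<in> topspace (KS_product X \<theta>). \<tau> e \<in> Some ` act_set \<theta> e}"
  proof (rule openin_continuous_map_preimage)
    show "continuous_map (KS_product X \<theta>) ?Xe (\<lambda>\<tau>. \<tau> e)"
      unfolding KS_product_def by (rule continuous_map_product_projection) fact
    show "openin ?Xe (Some ` act_set \<theta> e)"
      using e by (simp add: openin_subtopology_refl openin_subset[OF openin_act_set])
  qed
  then have "openin (KS_space X \<theta>)
      ((KS_tilde X \<theta> - {KS_infinity}) \<inter> {\<tau> \<in> topspace (KS_product X \<theta>). \<tau> e \<in> Some ` act_set \<theta> e})"
    unfolding KS_space_def by (rule openin_subtopology_Int2)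
  moreover have "(KS_tilde X \<theta> - {KS_infinity}) \<inter> {\<tau> \<in> topspace (KS_product X \<theta>). \<tau> e \<in> Some ` act_set \<theta> e}
      = act_set (KS_action X \<theta>) e"
    unfolding act_set_KS[OF e] topspace_KS_space KS_tilde_def topspace_KS_product
    using e by (fastforce simp: PiE_iff)
  ultimately show ?thesis by simp
qed

lemma openin_Some_vimage:
  assumes e: "e \<in> idempotents"
    and U: "openin (Alexandroff_compactification (subtopology X (act_set \<theta> e))) U"
  shows "openin X {x \<in> act_set \<theta> e. Some x \<in> U}"
proof -
  have "openin (subtopology X (act_set \<theta> e)) {x \<in> topspace (subtopology X (act_set \<theta> e)). Some x \<in> U}"
    using openin_continuous_map_preimage[OF continuous_map_Some U] by simp
  then show ?thesis
    using openin_open_subtopology[OF openin_act_set[OF e]] e by simp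
qed

end


section \<open>The map into $X^{\mathrm{KS}}$ induced by an equivariant map\<close>

locale equivariant_pair = \<theta>: topological_action \<theta> X + \<sigma>: topological_action \<sigma> Y
  for \<theta> :: "'s::inverse_semigroup \<Rightarrow> 'x \<rightharpoonup> 'x" and X :: "'x topology"
    and \<sigma> :: "'s \<Rightarrow> 'y \<rightharpoonup> 'y" and Y :: "'y topology" +
  fixes f :: "'y \<Rightarrow> 'x"
  assumes equivariant: "equivariant_map Y \<sigma> X \<theta> f"
begin

definition \<rho> :: "'y \<Rightarrow> 's \<Rightarrow> 'x option" where
  "\<rho> y = KS_point (f y) {e \<in> idempotents. y \<in> act_set \<sigma> e}"

lemma \<rho>_eq: "\<rho> = KS_map f \<circ> KS_iota \<sigma>"
  by (rule ext) (auto simp: \<rho>_def KS_point_def KS_map_def KS_iota_def restrict_def)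

lemma \<rho>_apply: "e \<in> idempotents \<Longrightarrow> \<rho> y e = (if y \<in> act_set \<sigma> e then Some (f y) else None)"
  by (simp add: \<rho>_def KS_point_apply)

lemma f_act_set: "e \<in> idempotents \<Longrightarrow> y \<in> act_set \<sigma> e \<Longrightarrow> f y \<in> act_set \<theta> e"
  using equivariant unfolding equivariant_map_def by blast

lemma f_equivariant:
  assumes "\<sigma> s y = Some w"
  shows "\<theta> s (f y) = Some (f w)"
proof -
  have y: "y \<in> act_set \<sigma> (star s * s)"
    by (rule \<sigma>.act_set_source[OF assms])
  then obtain v where "\<theta> s (f y) = Some v"
    using f_act_set[OF _ y] \<theta>.act_set_star_iff by auto
  moreover have "f (the (\<sigma> s y)) = the (\<theta> s (f y))"
    using equivariant y unfolding equivariant_map_def by blast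
  ultimately show ?thesis
    using assms by simp
qed

lemma domain_filter_\<rho>:
  assumes "y \<in> topspace Y"
  shows "domain_filter \<theta> (f y) {e \<in> idempotents. y \<in> act_set \<sigma> e}"
  unfolding domain_filter_def
proof (intro conjI ballI impI)
  show "{e \<in> idempotents. y \<in> act_set \<sigma> e} \<noteq> {}"
    using assms \<sigma>.act_sets_cover by blast
  show "e * e' \<in> {e \<in> idempotents. y \<in> act_set \<sigma> e}"
    if "e \<in> {e \<in> idempotents. y \<in> act_set \<sigma> e}" "e' \<in> {e \<in> idempotents. y \<in> act_set \<sigma> e}" for e e'
    using that by (simp add: idempotents_mult \<sigma>.act_set_mult)
  show "e' \<in> {e \<in> idempotents. y \<in> act_set \<sigma> e}"
    if "e \<in> {e \<in> idempotents. y \<in> act_set \<sigma> e}" "e' \<in> idempotents" "e' * e = e" for e e'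
    using that \<sigma>.act_set_mult[of e' e] by auto
qed (auto intro: f_act_set)

lemma \<rho>_in_KS_space: "y \<in> topspace Y \<Longrightarrow> \<rho> y \<in> topspace (KS_space X \<theta>)"
  unfolding \<rho>_def by (intro \<theta>.KS_point_in_KS_space domain_filter_\<rho>)

lemma \<rho>_equivariant:
  assumes "\<sigma> s y = Some w"
  shows "KS_action X \<theta> s (\<rho> y) = Some (\<rho> w)"
proof -
  have y: "y \<in> act_set \<sigma> (star s * s)"
    by (rule \<sigma>.act_set_source[OF assms])
  then have "y \<in> topspace Y"
    using \<sigma>.act_sets_cover by blast
  moreover have "\<theta>.push_filter s {e \<in> idempotents. y \<in> act_set \<sigma> e} = {e \<in> idempotents. w \<in> act_set \<sigma> e}"
    unfolding \<theta>.push_filter_def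
    using \<sigma>.act_set_conjugate[OF _ assms] idempotent_conjugate(2) by blast
  ultimately show ?thesis
    using y f_equivariant[OF assms] by (simp add: \<rho>_def \<theta>.KS_action_point[OF domain_filter_\<rho>])
qed

sublocale germ_map \<sigma> "KS_action X \<theta>" \<rho>
proof
  show "KS_action X \<theta> s (\<rho> y) = Some (\<rho> w)" if "\<sigma> s y = Some w" for s y w
    using that by (rule \<rho>_equivariant)
  show "y \<in> act_set \<sigma> e" if "e \<in> idempotents" "\<rho> y \<in> act_set (KS_action X \<theta>) e" for e y
    using that by (simp add: \<theta>.act_set_KS \<rho>_apply split: if_splits)
qed

lemma equivariant_map_\<rho>: "equivariant_map Y \<sigma> (KS_space X \<theta>) (KS_action X \<theta>) \<rho>"
  unfolding equivariant_map_def
proof (intro conjI ballI allI)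
  show "\<rho> \<in> topspace Y \<rightarrow> topspace (KS_space X \<theta>)"
    using \<rho>_in_KS_space by blast
  show "\<rho> ` act_set \<sigma> e \<subseteq> act_set (KS_action X \<theta>) e" if "e \<in> idempotents" for e
    using act_set_vimage[OF that] by blast
  show "\<rho> (the (\<sigma> s y)) = the (KS_action X \<theta> s (\<rho> y))" if y: "y \<in> act_set \<sigma> (star s * s)" for s y
  proof -
    obtain w where "\<sigma> s y = Some w"
      using y \<sigma>.act_set_star_iff by blast
    then show ?thesis
      using \<rho>_equivariant by simp
  qed
qed

lemma \<rho>_coordinate_vimage:
  assumes "e \<in> idempotents"
  shows "{y \<in> topspace Y. \<rho> y e \<in> U} = {y \<in> topspace Y. f y \<in> {x \<in> act_set \<theta> e. Some x \<in> U}} \<inter> act_set \<sigma> e \<union>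
    (if None \<in> U then topspace Y - act_set \<sigma> e else {})"
  using assms openin_subset[OF \<sigma>.openin_act_set[OF assms]] f_act_set[OF assms]
  by (auto simp: \<rho>_apply split: if_splits)

lemma continuous_map_\<rho>:
  assumes f: "continuous_map Y X f" and closed: "\<And>e. e \<in> idempotents \<Longrightarrow> closedin Y (act_set \<sigma> e)"
  shows "continuous_map Y (KS_space X \<theta>) \<rho>"
  unfolding KS_space_def continuous_map_in_subtopology
proof
  show "\<rho> \<in> topspace Y \<rightarrow> KS_tilde X \<theta> - {KS_infinity}"
    using \<rho>_in_KS_space unfolding \<theta>.topspace_KS_space by blast
  show "continuous_map Y (KS_product X \<theta>) \<rho>"
    unfolding KS_product_def continuous_map_componentwise
  proof (intro conjI ballI)
    show "\<rho> ` topspace Y \<subseteq> extensional idempotents"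
      by (auto simp: \<rho>_def KS_point_def)
    fix e :: 's assume e: "e \<in> idempotents"
    let ?Xe = "Alexandroff_compactification (subtopology X (act_set \<theta> e))"
    show "continuous_map Y ?Xe (\<lambda>y. \<rho> y e)"
      unfolding continuous_map
    proof (intro conjI allI impI)
      show "(\<lambda>y. \<rho> y e) ` topspace Y \<subseteq> topspace ?Xe"
        using e f_act_set[OF e] by (auto simp: \<rho>_apply)
      fix U assume "openin ?Xe U"
      then have "openin Y {y \<in> topspace Y. f y \<in> {x \<in> act_set \<theta> e. Some x \<in> U}}"
        by (rule openin_continuous_map_preimage[OF f \<theta>.openin_Some_vimage[OF e]])
      then show "openin Y {y \<in> topspace Y. \<rho> y e \<in> U}"
        unfolding \<rho>_coordinate_vimage[OF e] using closed[OF e] \<sigma>.openin_act_set[OF e]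
        by (auto intro!: openin_Un openin_Int)
    qed
  qed
qed

text \<open>Unless \<open>X\<close> is second countable, an open set of the product may fail to be a countable union
  of boxes, so measurability of the coordinates does not suffice. But the finite coordinates of
  \<open>\<rho> y\<close> all equal \<open>f y\<close>. For finite sets \<open>P\<close>, \<open>Q\<close> of idempotents let \<open>\<A> P Q\<close> consist of the open
  subsets \<open>A\<close> of \<open>X\<close> such that \<open>V\<close> contains every element with values in \<open>A\<close> on \<open>P\<close> and infinite on
  \<open>Q\<close>. If \<open>y\<close> lies in \<open>Y\<^sub>e\<close> for all \<open>e \<in> P\<close> and for no \<open>e \<in> Q\<close>, then \<open>\<rho> y\<close> belongs to \<open>V\<close> as soon
  as \<open>f y\<close> belongs to a member of \<open>\<A> P Q\<close>. Conversely, if \<open>\<rho> y \<in> V\<close> then a box around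
  \<open>\<rho> y\<close> inside \<open>V\<close> yields such \<open>P\<close> and \<open>Q\<close>. However large the family \<open>\<A> P Q\<close> is, its union
  is one open set. Where \<open>X\<^sub>e\<close> is empty the coordinate at \<open>e\<close> has only the value at infinity, so
  \<open>P\<close> and \<open>Q\<close> can be taken among the finite subsets of a countable set.\<close>

lemma borel_map_\<rho>:
  assumes f: "borel_map Y X f" and countable: "countable {e \<in> idempotents. act_set \<theta> e \<noteq> {}}"
  shows "borel_map Y (KS_space X \<theta>) \<rho>"
proof (rule borel_mapI)
  show "\<rho> ` topspace Y \<subseteq> topspace (KS_space X \<theta>)"
    using \<rho>_in_KS_space by blast
  fix W assume "openin (KS_space X \<theta>) W"
  then obtain V where V: "openin (KS_product X \<theta>) V" "W = V \<inter> (KS_tilde X \<theta> - {KS_infinity})"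
    unfolding KS_space_def openin_subtopology by blast
  define E where "E = {e \<in> idempotents. act_set \<theta> e \<noteq> {}}"
  define \<A> where "\<A> P Q = {A. openin X A \<and> (\<forall>\<tau>\<in>topspace (KS_product X \<theta>).
    (\<forall>e\<in>P. \<tau> e \<in> Some ` A) \<and> (\<forall>e\<in>Q. \<tau> e = None) \<longrightarrow> \<tau> \<in> V)}" for P Q
  define D where "D P Q = {y \<in> topspace Y. (\<forall>e\<in>P. y \<in> act_set \<sigma> e) \<and> (\<forall>e\<in>Q. y \<notin> act_set \<sigma> e)}" for P Q
  define I where "I = {P. finite P \<and> P \<subseteq> E} \<times> {P. finite P \<and> P \<subseteq> E}"
  have \<rho>_product: "\<rho> y \<in> topspace (KS_product X \<theta>)" if "y \<in> topspace Y" for y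
    using \<rho>_in_KS_space[OF that] unfolding \<theta>.topspace_KS_space KS_tilde_def by blast
  have "\<rho> -` W \<inter> topspace Y = (\<Union>(P, Q)\<in>I. D P Q \<inter> (f -` \<Union>(\<A> P Q) \<inter> topspace Y))" (is "?L = ?R")
  proof (intro equalityI subsetI)
    fix y assume "y \<in> ?L"
    then have y: "y \<in> topspace Y" "\<rho> y \<in> V"
      unfolding V(2) by auto
    obtain B where B: "finite {e \<in> idempotents. B e \<noteq> topspace (Alexandroff_compactification (subtopology X (act_set \<theta> e)))}"
        "\<And>e. e \<in> idempotents \<Longrightarrow> openin (Alexandroff_compactification (subtopology X (act_set \<theta> e))) (B e)"
        "\<rho> y \<in> Pi\<^sub>E idempotents B" "Pi\<^sub>E idempotents B \<subseteq> V"
      using V(1) y(2) unfolding KS_product_def openin_product_topology_alt by meson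
    \<comment> \<open>These are the finitely many coordinates that the box constrains.\<close>
    define K where "K = {e \<in> idempotents. B e \<noteq> insert None (Some ` act_set \<theta> e)}"
    define P where "P = {e \<in> K. y \<in> act_set \<sigma> e}"
    \<comment> \<open>Intersecting with the whole space covers the case of empty \<open>P\<close>.\<close>
    define A where "A = topspace X \<inter> (\<Inter>e\<in>P. {x \<in> act_set \<theta> e. Some x \<in> B e})"
    have "K = {e \<in> idempotents. B e \<noteq> topspace (Alexandroff_compactification (subtopology X (act_set \<theta> e)))}"
      unfolding K_def by auto
    then have K: "finite K" "K \<subseteq> idempotents"
      using B(1) by auto
    have \<rho>_B: "\<rho> y e \<in> B e" if "e \<in> idempotents" for e
      using B(3) that by (auto simp: PiE_iff)
    have B_sub: "B e \<subseteq> insert None (Some ` act_set \<theta> e)" if "e \<in> idempotents" for e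
      using openin_subset[OF B(2)[OF that]] that by simp
    \<comment> \<open>If \<open>X\<^sub>e\<close> is empty, the factor at \<open>e\<close> is a single point, and a nonempty box contains it.\<close>
    have "K \<subseteq> E"
    proof
      fix e assume e: "e \<in> K"
      then have "e \<in> idempotents" "B e \<noteq> insert None (Some ` act_set \<theta> e)"
        unfolding K_def by auto
      then have "act_set \<theta> e \<noteq> {}"
        using \<rho>_B[of e] B_sub[of e] by auto
      then show "e \<in> E"
        using \<open>e \<in> idempotents\<close> unfolding E_def by blast
    qed
    have P: "finite P" "P \<subseteq> K"
      using K(1) unfolding P_def by auto
    have "openin X A"
    proof (cases "P = {}")
      case True
      then show ?thesis unfolding A_def by simp
    next
      case False
      have "openin X (\<Inter>e\<in>P. {x \<in> act_set \<theta> e. Some x \<in> B e})"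
      proof (rule openin_INT2[OF P(1) False])
        fix e assume "e \<in> P"
        then have e: "e \<in> idempotents"
          using P(2) K(2) by blast
        show "openin X {x \<in> act_set \<theta> e. Some x \<in> B e}"
          by (rule \<theta>.openin_Some_vimage[OF e B(2)[OF e]])
      qed
      then show ?thesis
        unfolding A_def by (simp add: openin_Int)
    qed
    moreover have "\<tau> \<in> V" if \<tau>: "\<tau> \<in> topspace (KS_product X \<theta>)"
      "\<forall>e\<in>P. \<tau> e \<in> Some ` A" "\<forall>e\<in>K - P. \<tau> e = None" for \<tau>
    proof -
      have "\<tau> e \<in> B e" if e: "e \<in> idempotents" for e
      proof -
        consider "e \<in> P" | "e \<in> K - P" | "e \<notin> K" by blast
        then show ?thesis
        proof cases
          case 1
          then obtain x where "\<tau> e = Some x" "x \<in> A"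
            using \<tau>(2) by blast
          then show ?thesis
            using 1 unfolding A_def by simp
        next
          case 2
          then have "\<rho> y e = None"
            using e unfolding P_def by (simp add: \<rho>_apply)
          then show ?thesis
            using 2 \<tau>(3) \<rho>_B[OF e] by simp
        next
          case 3
          then have "B e = insert None (Some ` act_set \<theta> e)"
            using e unfolding K_def by blast
          then show ?thesis
            using \<tau>(1) e unfolding \<theta>.topspace_KS_product by (auto simp: PiE_iff)
        qed
      qed
      then have "\<tau> \<in> Pi\<^sub>E idempotents B"
        using \<tau>(1) unfolding \<theta>.topspace_KS_product by (auto simp: PiE_iff)
      then show ?thesis
        using B(4) by blast
    qed
    ultimately have "A \<in> \<A> P (K - P)"
      unfolding \<A>_def by blast
    moreover have "f y \<in> A"
    proof -
      have "f y \<in> topspace X"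
        using equivariant y(1) unfolding equivariant_map_def by blast
      moreover have "f y \<in> act_set \<theta> e \<and> Some (f y) \<in> B e" if e: "e \<in> P" for e
      proof -
        have "e \<in> idempotents" "y \<in> act_set \<sigma> e"
          using e P(2) K(2) unfolding P_def by auto
        then show ?thesis
          using f_act_set \<rho>_B[of e] by (simp add: \<rho>_apply)
      qed
      ultimately show ?thesis
        unfolding A_def by blast
    qed
    moreover have "y \<in> D P (K - P)"
      using y(1) unfolding D_def P_def by blast
    moreover have "(P, K - P) \<in> I"
      using P K \<open>K \<subseteq> E\<close> unfolding I_def by auto
    ultimately show "y \<in> ?R"
      using y(1) by blast
  next
    fix y assume "y \<in> ?R"
    then obtain P Q A where PQ: "(P, Q) \<in> I" "y \<in> D P Q" "A \<in> \<A> P Q" "f y \<in> A"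
      by blast
    then have y: "y \<in> topspace Y"
      unfolding D_def by blast
    have PQ_idem: "P \<subseteq> idempotents" "Q \<subseteq> idempotents"
      using PQ(1) unfolding I_def E_def by auto
    have "\<rho> y e \<in> Some ` A" if "e \<in> P" for e
      using that PQ(2,4) PQ_idem unfolding D_def by (auto simp: \<rho>_apply subset_iff)
    moreover have "\<rho> y e = None" if "e \<in> Q" for e
      using that PQ(2) PQ_idem unfolding D_def by (auto simp: \<rho>_apply subset_iff)
    ultimately have "\<rho> y \<in> V"
      using PQ(3) \<rho>_product[OF y] unfolding \<A>_def by blast
    then show "y \<in> ?L"
      using y \<rho>_in_KS_space[OF y] unfolding V(2) \<theta>.topspace_KS_space by blast
  qed
  moreover have "?R \<in> sets (borel_algebra Y)"
  proof (rule sets.countable_UN', goal_cases)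
    case 1
    have "countable {P. finite P \<and> P \<subseteq> E}"
      using countable unfolding E_def[symmetric] by (rule countable_Collect_finite_subset)
    then show ?case
      unfolding I_def by blast
  next
    case 2
    have "D P Q \<inter> (f -` \<Union>(\<A> P Q) \<inter> topspace Y) \<in> sets (borel_algebra Y)" if "(P, Q) \<in> I" for P Q
    proof (rule sets.Int)
      have PQ: "finite P" "finite Q" "P \<subseteq> idempotents" "Q \<subseteq> idempotents"
        using that unfolding I_def E_def by auto
      have act: "act_set \<sigma> e \<in> sets (borel_algebra Y)" if "e \<in> idempotents" for e
        by (rule openin_borel_algebra[OF \<sigma>.openin_act_set[OF that]])
      have "(\<Union>e\<in>Q. act_set \<sigma> e) \<in> sets (borel_algebra Y)"
        using PQ(4) by (intro sets.finite_UN PQ act) auto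
      moreover have "(\<Union>e\<in>P. topspace Y - act_set \<sigma> e) \<in> sets (borel_algebra Y)"
        using PQ(3) by (intro sets.finite_UN PQ sets.Diff openin_borel_algebra[OF openin_topspace] act) auto
      moreover have "D P Q = topspace Y - (\<Union>e\<in>Q. act_set \<sigma> e) - (\<Union>e\<in>P. topspace Y - act_set \<sigma> e)"
        unfolding D_def by blast
      ultimately show "D P Q \<in> sets (borel_algebra Y)"
        using openin_borel_algebra[OF openin_topspace[of Y]] by auto
      have "openin X (\<Union>(\<A> P Q))"
        unfolding \<A>_def by blast
      then show "f -` \<Union>(\<A> P Q) \<inter> topspace Y \<in> sets (borel_algebra Y)"
        by (rule borel_mapD[OF f openin_borel_algebra])
    qed
    then show ?case
      by auto
  qed
  ultimately show "\<rho> -` W \<inter> topspace Y \<in> sets (borel_algebra Y)"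
    by simp
qed

end


section \<open>The induced homomorphism is $d$-bijective, Borel or continuous\<close>

theorem theorem3p3p5:
  fixes X :: "'x topology" and Y :: "'y topology"
    and \<theta> :: "'s::inverse_semigroup \<Rightarrow> 'x \<rightharpoonup> 'x"
    and \<sigma> :: "'s \<Rightarrow> 'y \<rightharpoonup> 'y"
    and f :: "'y \<Rightarrow> 'x"
    and \<rho> :: "'y \<Rightarrow> 's \<Rightarrow> 'x option"
    and \<rho>' :: "('s \<times> 'y) set \<Rightarrow> ('s \<times> ('s \<Rightarrow> 'x option)) set"
  assumes "locally_compact_space X" and "Hausdorff_space X" and "isg_action X \<theta>"
    and "locally_compact_space Y" and "Hausdorff_space Y" and "isg_action Y \<sigma>"
    and "equivariant_map Y \<sigma> X \<theta> f"
    and rho: "\<rho> = KS_map f \<circ> KS_iota \<sigma>"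
    and rho': "\<rho>' = transformation_map \<sigma> (KS_action X \<theta>) \<rho>"
  shows
    "equivariant_map Y \<sigma> (KS_space X \<theta>) (KS_action X \<theta>) \<rho> \<and>
     (\<forall>y\<in>topspace Y. \<forall>e\<in>idempotents. \<rho> y e = (if y \<in> act_set \<sigma> e then Some (f y) else None)) \<and>
     (\<forall>s. \<forall>y\<in>act_set \<sigma> (star s * s). \<rho>' (germ \<sigma> s y) = germ (KS_action X \<theta>) s (\<rho> y)) \<and>
     groupoid_hom (transformation_groupoid \<sigma>) (transformation_groupoid (KS_action X \<theta>)) \<rho>' \<and>
     d_bijective (transformation_groupoid \<sigma>) (transformation_groupoid (KS_action X \<theta>)) \<rho>' \<and>
     (countable {s. act_set \<theta> (star s * s) \<noteq> {}} \<and> borel_map Y X f \<longrightarrow>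
        borel_map (transformation_topology Y \<sigma>)
                  (transformation_topology (KS_space X \<theta>) (KS_action X \<theta>)) \<rho>') \<and>
     (continuous_map Y X f \<and> (\<forall>e\<in>idempotents. closedin Y (act_set \<sigma> e)) \<longrightarrow>
        continuous_map (transformation_topology Y \<sigma>)
                       (transformation_topology (KS_space X \<theta>) (KS_action X \<theta>)) \<rho>')"
proof -
  interpret P: equivariant_pair \<theta> X \<sigma> Y f
    using assms by (simp add: equivariant_pair_def equivariant_pair_axioms_def isg_action_topological_action)
  have \<rho>: "\<rho> = P.\<rho>"
    unfolding rho P.\<rho>_eq ..
  show ?thesis
    unfolding rho' \<rho>
  proof (intro conjI impI ballI allI)
    show "equivariant_map Y \<sigma> (KS_space X \<theta>) (KS_action X \<theta>) P.\<rho>"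
      by (rule P.equivariant_map_\<rho>)
    show "P.\<rho> y e = (if y \<in> act_set \<sigma> e then Some (f y) else None)" if "e \<in> idempotents" for y e
      using that by (rule P.\<rho>_apply)
    show "P.\<rho>' (germ \<sigma> s y) = germ (KS_action X \<theta>) s (P.\<rho> y)" if "y \<in> act_set \<sigma> (star s * s)" for s y
      using that P.transformation_map_germ P.\<sigma>.act_set_star_iff by blast
    show "groupoid_hom P.\<sigma>.G P.\<theta>.KS.G P.\<rho>'"
      by (rule P.groupoid_hom_transformation_map)
    show "d_bijective P.\<sigma>.G P.\<theta>.KS.G P.\<rho>'"
      by (rule P.d_bijective_transformation_map)
  next
    assume *: "countable {s. act_set \<theta> (star s * s) \<noteq> {}} \<and> borel_map Y X f"
    have "{e \<in> idempotents. act_set \<theta> e \<noteq> {}} \<subseteq> {s. act_set \<theta> (star s * s) \<noteq> {}}"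
      by (auto simp: star_idempotent idempotent_square)
    then have "borel_map Y (KS_space X \<theta>) P.\<rho>"
      using * P.borel_map_\<rho> countable_subset by blast
    moreover have "countable {s. act_set (KS_action X \<theta>) (star s * s) \<noteq> {}}"
      by (rule countable_subset[OF _ conjunct1[OF *]]) (use P.\<theta>.act_set_KS_nonempty in auto)
    ultimately show "borel_map (transformation_topology Y \<sigma>)
        (transformation_topology (KS_space X \<theta>) (KS_action X \<theta>)) P.\<rho>'"
      using P.borel_transformation_map[OF P.\<sigma>.openin_act_set P.\<theta>.openin_act_set_KS] by blast
  next
    assume "continuous_map Y X f \<and> (\<forall>e\<in>idempotents. closedin Y (act_set \<sigma> e))"
    then show "continuous_map (transformation_topology Y \<sigma>)
        (transformation_topology (KS_space X \<theta>) (KS_action X \<theta>)) P.\<rho>'"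
      using P.continuous_transformation_map[OF P.\<sigma>.openin_act_set P.\<theta>.openin_act_set_KS P.continuous_map_\<rho>]
      by blast
  qed
qed

end
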